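(* There exist constants $c_n, C_n>0$ depending only on the dimension $n$ such that for every weight $v$ on $\mathbb{R}^n$ and every functional $Y:\mathcal{Q}\to(0,\infty)$, $$c_n\,[v]_{A_{\infty,Y}}\ \le\ \sup_{b:\ \|b\|_{\mathrm{BMO}}=1}\|b\|_{\mathrm{BMO}_{v,Y}}\ \le\ C_n\,[v]_{A_{\infty,Y}}.$$ In other words, $[v]_{A_{\infty,Y}}\approx \sup_{b:\|b\|_{\mathrm{BMO}}=1}\ \sup_{Q\in\mathcal{Q}}\frac{1}{Y(Q)}\int_Q|b(x)-b_Q|\,v(x)\,dx$, with implicit constants depending only on $n$.
   Context: A weight is a non-negative locally integrable function on $\mathbb{R}^n$. $\mathcal{Q}$ is the family of all cubes in $\mathbb{R}^n$ with sides parallel to the axes. For $f\in L^1_{loc}(\mathbb{R}^n)$ and a cube $Q$, $f_Q=\frac{1}{|Q|}\int_Q f$. No condition is imposed on $Y:\mathcal{Q}\to(0,\infty)$. Define, for $f\in L^1_{loc}(\mathbb{R}^n)$, $$\|f\|_{\mathrm{BMO}_{v,Y}}=\sup_{Q\in\mathcal{Q}}\frac{1}{Y(Q)}\int_Q|f-f_Q|\,v\,dx,\qquad \|f\|_{\mathrm{BMO}}=\sup_{Q\in\mathcal{Q}}\frac{1}{|Q|}\int_Q|f-f_Q|\,dx,$$ and $$[v]_{A_{\infty,Y}}=\sup_{Q\in\mathcal{Q}}\frac{1}{Y(Q)}\int_Q M(v\chi_Q)\,dx,$$ where $M$ is the Hardy–Littlewood maximal operator, $Mg(x)=\sup_{R\ni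 x,\ R\in\mathcal{Q}}\frac{1}{|R|}\int_R|g|$. These quantities may equal $+\infty$. *)

theory Defs
  imports "HOL-Analysis.Analysis"
begin

text \<open>The dimension \<open>n\<close> is \<open>CARD('n)\<close>. Cubes are closed and nondegenerate.
  All the quantities that may be infinite take values in \<^typ>\<open>ennreal\<close>.\<close>

definition cubes :: "(real ^ 'n) set set" where
  "cubes = {cbox a (a + (\<chi> i. l)) | a l. 0 < l}"

definition locally_integrable :: "(real ^ 'n \<Rightarrow> real) \<Rightarrow> bool" where
  "locally_integrable f \<longleftrightarrow> (\<forall>K. compact K \<longrightarrow> set_integrable lebesgue K f)"

definition weight :: "(real ^ 'n \<Rightarrow> real) \<Rightarrow> bool" where
  "weight v \<longleftrightarrow> locally_integrable v \<and> (\<forall>x. 0 \<le> v x)"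

definition average :: "(real ^ 'n \<Rightarrow> real) \<Rightarrow> (real ^ 'n) set \<Rightarrow> real" where
  "average f Q = (1 / measure lebesgue Q) * (LINT x:Q|lebesgue. f x)"

definition BMO_norm :: "(real ^ 'n \<Rightarrow> real) \<Rightarrow> ennreal" where
  "BMO_norm f =
     (SUP Q\<in>cubes. (\<integral>\<^sup>+x\<in>Q. ennreal \<bar>f x - average f Q\<bar> \<partial>lebesgue) / emeasure lebesgue Q)"

definition weighted_BMO_norm ::
    "(real ^ 'n \<Rightarrow> real) \<Rightarrow> ((real ^ 'n) set \<Rightarrow> real) \<Rightarrow> (real ^ 'n \<Rightarrow> real) \<Rightarrow> ennreal" where
  "weighted_BMO_norm v Y f =
     (SUP Q\<in>cubes. (\<integral>\<^sup>+x\<in>Q. ennreal (\<bar>f x - average f Q\<bar> * v x) \<partial>lebesgue) / ennreal (Y Q))"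

definition maximal_function :: "(real ^ 'n \<Rightarrow> real) \<Rightarrow> real ^ 'n \<Rightarrow> ennreal" where
  "maximal_function g x =
     (SUP R\<in>{R \<in> cubes. x \<in> R}. (\<integral>\<^sup>+y\<in>R. ennreal \<bar>g y\<bar> \<partial>lebesgue) / emeasure lebesgue R)"

definition A_infinity_constant ::
    "(real ^ 'n \<Rightarrow> real) \<Rightarrow> ((real ^ 'n) set \<Rightarrow> real) \<Rightarrow> ennreal" where
  "A_infinity_constant v Y =
     (SUP Q\<in>cubes.
        (\<integral>\<^sup>+x\<in>Q. maximal_function (\<lambda>y. v y * indicator Q y) x \<partial>lebesgue) / ennreal (Y Q))"

end

theory Submission
  imports Defs
begin

text \<open>
  Throughout, \<open>M\<close> is the maximal operator, \<open>f\<^sub>Q\<close> the average of \<open>f\<close> on \<open>Q\<close>, \<open>n\<close> the dimension and \<open>A\<close> a weak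
  type constant of \<open>M\<close>.

  Lower bound. Fix a cube \<open>Q\<close>, let \<open>\<nu>\<close> be the measure with density \<open>v\<close> on \<open>Q\<close>, and let \<open>\<tau>\<close> be the average
  of \<open>v\<close> on \<open>Q\<close>. Let \<open>b(x)\<close> be the number of \<open>k \<ge> 0\<close> with \<open>2\<^sup>k\<tau> < M\<nu>(x)\<close>, which is a discrete logarithm of
  \<open>M\<nu>/\<tau>\<close>. As in the theorem of Coifman and Rochberg, it lies in BMO with a norm bounded in terms of \<open>n\<close>
  (\<open>level_count_oscillation\<close>): on a cube \<open>R\<close>, the mass far away from \<open>R\<close> influences \<open>M\<nu>\<close> in an almost
  constant way, and the mass near \<open>R\<close> is handled by the weak type inequality. The weak type inequality
  holds in the form \<open>t |{M\<nu> > t}| \<le> A \<nu>{M\<nu> > t}\<close>, with the same level set on both sides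
  (\<open>maximal_weak_type\<close>). Summed over the levels \<open>t = 2\<^sup>k\<tau>\<close> it bounds the integral of \<open>M\<nu>\<close> over \<open>Q\<close> by
  \<open>\<nu>(Q)\<close> plus \<open>A\<close> times the \<open>\<nu>\<close>-integral of \<open>b\<close> (\<open>nn_integral_maximal_le_level_count\<close>). Since
  \<open>b\<^sub>Q \<le> 2A\<close>, the function \<open>b\<close> may be replaced by \<open>|b - b\<^sub>Q|\<close> at the cost of another multiple of \<open>\<nu>(Q)\<close>; and
  \<open>\<nu>(Q)\<close> itself is twice the weighted oscillation of the indicator of a half-space that halves \<open>Q\<close>.

  Upper bound. Let \<open>b\<close> have BMO norm at most 1 and let \<open>w\<close> be a weight bounded by \<open>m\<close>. The
  Calderon-Zygmund decomposition of \<open>|b - b\<^sub>Q|\<close> at height 2 yields disjoint dyadic subcubes \<open>P\<close> of \<open>Q\<close>, filling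
  at most half of \<open>Q\<close>, with \<open>|b\<^sub>P - b\<^sub>Q| \<le> 2\<^sup>n\<^sup>+\<^sup>1\<close>, outside of which \<open>|b - b\<^sub>Q| \<le> 2\<close>. Hence the \<open>w\<close>-oscillation of
  \<open>b\<close> on \<open>Q\<close> is at most \<open>2\<^sup>n\<^sup>+\<^sup>1 w(Q)\<close> plus the sum of the \<open>w\<close>-oscillations of \<open>b\<close> on the cubes \<open>P\<close>. The set
  \<open>G\<close> outside the cubes \<open>P\<close> fills at least half of \<open>Q\<close>, and there the maximal function of \<open>w\<close> restricted to
  \<open>Q\<close> is at least \<open>w(Q)/|Q|\<close>; so \<open>w(Q)\<close> is at most twice its integral over \<open>G\<close>. Consequently, if on each cube
  the \<open>w\<close>-oscillation is bounded by \<open>2\<^sup>n\<^sup>+\<^sup>2\<close> times the integral of the maximal function, up to an error of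
  \<open>e\<close> per unit of volume, then the same is true with \<open>e/2\<close> (\<open>oscillation_step\<close>). The estimate holds with
  \<open>e = m\<close> by the BMO condition, hence with \<open>e = 0\<close>, and monotone convergence in \<open>w\<close> removes the
  boundedness assumption.
\<close>

section \<open>Cubes\<close>

definition cube :: "real ^ 'n \<Rightarrow> real \<Rightarrow> (real ^ 'n) set" where
  "cube a l = cbox a (a + (\<chi> i. l))"

definition half_open_cube :: "real ^ 'n \<Rightarrow> real \<Rightarrow> (real ^ 'n) set" where
  "half_open_cube a l = {x. \<forall>i. a $ i \<le> x $ i \<and> x $ i < a $ i + l}"

lemma cubes_eq: "cubes = {cube a l | a l. 0 < l}"
  by (simp add: cubes_def cube_def)

lemma cube_in_cubes [simp]: "0 < l \<Longrightarrow> cube a l \<in> cubes"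
  by (auto simp: cubes_eq)

lemma cubesE:
  assumes "Q \<in> cubes" obtains a l where "Q = cube a l" "0 < l"
  using assms by (auto simp: cubes_eq)

lemma mem_cube: "x \<in> cube a l \<longleftrightarrow> (\<forall>i. a $ i \<le> x $ i \<and> x $ i \<le> a $ i + l)"
  by (simp add: cube_def mem_box_cart)

lemma half_open_cube_subset_cube: "half_open_cube a l \<subseteq> cube a l"
  by (auto simp: mem_cube half_open_cube_def less_imp_le)

lemma half_open_cube_eq_halfspaces:
  "half_open_cube a l = (\<Inter>i. {x. a $ i \<le> x $ i} \<inter> {x. x $ i < a $ i + l})"
  by (auto simp: half_open_cube_def)

lemma sets_lebesgue_half_open_cube [measurable, simp]:
  fixes a :: "real ^ 'n"
  shows "half_open_cube a l \<in> sets lebesgue"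
proof -
  have "{x :: real ^ 'n. a $ i \<le> x $ i} \<inter> {x. x $ i < a $ i + l} \<in> sets borel" for i
    by (intro sets.Int borel_closed borel_open closed_Collect_le open_Collect_less continuous_intros)
  then have "half_open_cube a l \<in> sets borel"
    unfolding half_open_cube_eq_halfspaces by (intro sets.countable_INT'') auto
  then show ?thesis by simp
qed

lemma sets_lebesgue_cube [measurable, simp]: "cube a l \<in> sets lebesgue"
  by (simp add: cube_def)

lemma emeasure_cube:
  fixes a :: "real ^ 'n"
  assumes "0 < l" shows "emeasure lebesgue (cube a l) = ennreal (l ^ CARD('n))"
proof -
  have "cbox a (a + (\<chi> i. l)) \<noteq> {}"
    using assms by (auto simp: interval_eq_empty_cart not_less less_imp_le)
  then have "measure lborel (cube a l) = l ^ CARD('n)"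
    unfolding cube_def by (subst content_cbox_cart) auto
  moreover have "emeasure lborel (cube a l) = ennreal (measure lborel (cube a l))"
    unfolding cube_def using emeasure_lborel_cbox_finite[of a "a + (\<chi> i. l)"]
    by (intro emeasure_eq_ennreal_measure) auto
  ultimately show ?thesis
    by (simp add: cube_def)
qed

text \<open>The default rewriting of Lebesgue measure to Borel measure of a main part would hide the volume formulas for
  cubes from the simplifier.\<close>

declare emeasure_completion [simp del]

lemma cube_diff_null: "cube a l - half_open_cube a l \<in> null_sets lebesgue"
proof -
  have "cube a l - half_open_cube a l \<subseteq> cbox a (a + (\<chi> i. l)) - box a (a + (\<chi> i. l))"
    by (auto simp: half_open_cube_def cube_def mem_box_cart less_imp_le)
  then have "negligible (cube a l - half_open_cube a l)"
    using negligible_frontier_interval negligible_subset by blast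
  then show ?thesis
    by (simp add: negligible_iff_null_sets)
qed

lemma AE_half_open_cube_iff: "AE x in lebesgue. x \<in> half_open_cube a l \<longleftrightarrow> x \<in> cube a l"
  using AE_not_in[OF cube_diff_null] by eventually_elim (use half_open_cube_subset_cube in auto)

lemma emeasure_half_open_cube:
  fixes a :: "real ^ 'n"
  assumes "0 < l" shows "emeasure lebesgue (half_open_cube a l) = ennreal (l ^ CARD('n))"
  using emeasure_eq_AE[OF AE_half_open_cube_iff, of a l] emeasure_cube[OF assms] by simp

text \<open>Closed cubes are the ones in \<^const>\<open>cubes\<close>, while half-open ones tile space without overlap.
  Integrals do not see the difference.\<close>

lemma nn_integral_half_open_cube:
  "(\<integral>\<^sup>+x\<in>half_open_cube a l. f x \<partial>lebesgue) = (\<integral>\<^sup>+x\<in>cube a l. f x \<partial>lebesgue)"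
  using AE_half_open_cube_iff[of a l]
  by (intro nn_integral_cong_AE) (auto elim!: eventually_mono simp: indicator_def)

lemma cube_subset_cball:
  fixes a :: "real ^ 'n"
  shows "cube a l \<subseteq> cball a (real CARD('n) * l)"
proof
  fix x assume "x \<in> cube a l"
  then have "a $ i \<le> x $ i \<and> x $ i \<le> a $ i + l" for i by (simp add: mem_cube)
  then have "\<bar>(x - a) $ i\<bar> \<le> l" for i by (smt (verit, best) vector_minus_component)
  with norm_le_l1_cart[of "x - a"] have "norm (x - a) \<le> (\<Sum>i\<in>(UNIV :: 'n set). l)"
    by (meson order_trans sum_mono)
  then show "x \<in> cball a (real CARD('n) * l)"
    by (simp add: dist_norm norm_minus_commute)
qed

lemma cball_subset_cube: "cball a r \<subseteq> cube (a - (\<chi> i. r)) (2 * r)"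
proof
  fix x assume "x \<in> cball a r"
  then have "\<bar>(x - a) $ i\<bar> \<le> r" for i
    using component_le_norm_cart[of "x - a" i] by (simp add: dist_norm norm_minus_commute)
  from this[unfolded abs_le_iff] show "x \<in> cube (a - (\<chi> i. r)) (2 * r)"
    by (fastforce simp: mem_cube algebra_simps)
qed

section \<open>The maximal function of a measure\<close>

text \<open>Working with a measure instead of its density allows the mass of a weight to be restricted to a cube, and the
  mass of a level set to be measured, without carrying integrands along.\<close>

definition maximal :: "(real ^ 'n) measure \<Rightarrow> real ^ 'n \<Rightarrow> ennreal" where
  "maximal \<nu> x = (SUP R\<in>{R \<in> cubes. x \<in> R}. emeasure \<nu> R / emeasure lebesgue R)"

lemma less_divide_ennreal_iff:
  fixes a b t :: ennreal
  assumes "b \<noteq> 0" "b \<noteq> top"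
  shows "t < a / b \<longleftrightarrow> t * b < a"
proof -
  have *: "(t * b) / b = t" "(a / b) * b = a"
    using assms by (simp_all add: ennreal_mult_divide_eq ennreal_divide_times less_top)
  have "a / b \<le> t \<longleftrightarrow> a \<le> t * b"
  proof
    assume "a / b \<le> t"
    from mult_right_mono[OF this, of b] show "a \<le> t * b" by (simp add: *)
  next
    assume "a \<le> t * b"
    from divide_right_mono_ennreal[OF this, of b] show "a / b \<le> t" by (simp add: *)
  qed
  then show ?thesis by (simp add: not_le[symmetric])
qed

text \<open>The superlevel sets without suprema and quotients, in a form in which the masses of two cubes can be compared
  directly.\<close>

lemma less_maximal_iff:
  fixes x :: "real ^ 'n"
  shows "t < maximal \<nu> x \<longleftrightarrow>
    (\<exists>a l. 0 < l \<and> x \<in> cube a l \<and> t * ennreal (l ^ CARD('n)) < emeasure \<nu> (cube a l))"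
proof -
  have "t < emeasure \<nu> (cube a l) / emeasure lebesgue (cube a l) \<longleftrightarrow>
        t * ennreal (l ^ CARD('n)) < emeasure \<nu> (cube a l)" if "0 < l" for a and l :: real
    using that by (subst less_divide_ennreal_iff) (auto simp: emeasure_cube)
  then show ?thesis
    unfolding maximal_def less_SUP_iff by (simp add: cubes_eq) blast
qed

text \<open>A closed cube of average above \<open>t\<close> can be enlarged a little on all sides with the average still
  above \<open>t\<close>, and the enlargement is a neighbourhood of each point of the cube.\<close>

lemma open_maximal_greater: "open {x. t < maximal \<nu> x}" if "sets \<nu> = sets lebesgue" for \<nu> :: "(real ^ 'n) measure"
proof (rule openI)
  fix x assume "x \<in> {x. t < maximal \<nu> x}"
  then obtain a l where al: "0 < l" "x \<in> cube a l" 
    "t * ennreal (l ^ CARD('n)) < emeasure \<nu> (cube a l)"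
    by (auto simp: less_maximal_iff)
  have fin: "t \<noteq> top"
    using al by (auto simp: ennreal_top_mult)
  have "((\<lambda>e. t * ennreal ((l + 2 * e) ^ CARD('n))) \<longlongrightarrow> t * ennreal ((l + 2 * 0) ^ CARD('n))) (at_right 0)"
    using fin by (intro ennreal_tendsto_cmult tendsto_ennrealI tendsto_intros) (auto simp: top.not_eq_extremum)
  then have "\<forall>\<^sub>F e in at_right 0. t * ennreal ((l + 2 * e) ^ CARD('n)) < emeasure \<nu> (cube a l)"
    by (rule order_tendstoD) (use al in simp)
  moreover have "\<forall>\<^sub>F e in at_right 0. (0 :: real) < e"
    by (simp add: eventually_at_right_less)
  ultimately have "\<forall>\<^sub>F e in at_right (0::real). 0 < e \<and> t * ennreal ((l + 2 * e) ^ CARD('n)) < emeasure \<nu> (cube a l)"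
    by eventually_elim auto
  then obtain e :: real where e: "0 < e" "t * ennreal ((l + 2 * e) ^ CARD('n)) < emeasure \<nu> (cube a l)"
    by (metis (no_types, lifting) eventually_happens trivial_limit_at_right_real)
  let ?R = "cube (a - (\<chi> i. e)) (l + 2 * e)"
  have "emeasure \<nu> (cube a l) \<le> emeasure \<nu> ?R"
  proof (rule emeasure_mono)
    show "cube a l \<subseteq> ?R"
    proof
      fix y assume "y \<in> cube a l"
      then have "a $ i \<le> y $ i \<and> y $ i \<le> a $ i + l" for i by (simp add: mem_cube)
      then have "a $ i - e \<le> y $ i \<and> y $ i \<le> a $ i - e + (l + 2 * e)" for i
        using e(1) by (smt (verit, best))
      then show "y \<in> ?R" by (simp add: mem_cube)
    qed
  qed (simp add: that)
  then have "y \<in> ?R \<Longrightarrow> t < maximal \<nu> y" for y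
    using e al unfolding less_maximal_iff
    by (intro exI[of _ "a - (\<chi> i. e)"] exI[of _ "l + 2 * e"]) (auto intro: less_le_trans)
  moreover have "ball x e \<subseteq> ?R"
  proof
    fix y assume "y \<in> ball x e"
    then have "\<bar>(x - y) $ i\<bar> < e" for i
      using component_le_norm_cart[of "x - y" i] by (simp add: dist_norm)
    then have *: "\<bar>x $ i - y $ i\<bar> < e" for i by simp
    have "a $ i \<le> x $ i \<and> x $ i \<le> a $ i + l" for i using al(2) by (auto simp: mem_cube)
    with * have "a $ i - e \<le> y $ i \<and> y $ i \<le> a $ i - e + (l + 2 * e)" for i
      by (smt (verit, best))
    then show "y \<in> ?R" by (simp add: mem_cube)
  qed
  ultimately show "\<exists>e>0. ball x e \<subseteq> {x. t < maximal \<nu> x}"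
    using e(1) by (intro exI[of _ e]) auto
qed

text \<open>With side length \<open>l\<close>, a cube sits in the ball of radius \<open>n l\<close> around its corner, and
  the ball of radius \<open>5 n l\<close> sits in a cube of side \<open>10 n l\<close>; the constant is the ratio
  of the two volumes.\<close>

definition weak_type_constant :: "'n itself \<Rightarrow> real" where
  "weak_type_constant _ = (10 * CARD('n)) ^ CARD('n)"

lemma emeasure_UN_countable_le:
  assumes "countable I" "\<And>i. i \<in> I \<Longrightarrow> X i \<in> sets M"
  shows "emeasure M (\<Union>i\<in>I. X i) \<le> (\<integral>\<^sup>+i. emeasure M (X i) \<partial>count_space I)"
proof -
  have "emeasure M (\<Union>i\<in>I. X i) = (\<integral>\<^sup>+x. indicator (\<Union>i\<in>I. X i) x \<partial>M)"
    using assms by (intro nn_integral_indicator[symmetric] sets.countable_UN') auto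
  also have "\<dots> \<le> (\<integral>\<^sup>+x. \<integral>\<^sup>+i. indicator (X i) x \<partial>count_space I \<partial>M)"
  proof (intro nn_integral_mono)
    fix x
    show "indicator (\<Union>i\<in>I. X i) x \<le> (\<integral>\<^sup>+i. indicator (X i) x \<partial>count_space I :: ennreal)"
    proof (cases "x \<in> (\<Union>i\<in>I. X i)")
      case True
      then obtain i where "i \<in> I" "x \<in> X i" by auto
      then have "1 \<le> (\<integral>\<^sup>+i. indicator (X i) x \<partial>count_space I :: ennreal)"
        using nn_integral_ge_point[of i I "\<lambda>i. indicator (X i) x"] by simp
      then show ?thesis
        by (rule order_trans[rotated]) (simp add: indicator_def)
    qed auto
  qed
  also have "\<dots> = (\<integral>\<^sup>+i. \<integral>\<^sup>+x. indicator (X i) x \<partial>M \<partial>count_space I)"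
    using assms by (intro nn_integral_count_space_nn_integral) auto
  also have "\<dots> = (\<integral>\<^sup>+i. emeasure M (X i) \<partial>count_space I)"
    using assms by (intro nn_integral_cong) auto
  finally show ?thesis .
qed

text \<open>Vitali's covering lemma selects disjoint cubes of average above \<open>t\<close> whose enlargements cover the
  level set. The selected cubes themselves lie inside the level set, so their mass is bounded by the mass of the
  level set and not only by the total mass. This gain is what makes the sum over levels in
  \<open>nn_integral_maximal_le_level_count\<close> an integral of the level count against the measure.\<close>

theorem maximal_weak_type:
  fixes \<nu> :: "(real ^ 'n) measure"
  assumes sets: "sets \<nu> = sets lebesgue" and fin: "emeasure \<nu> UNIV < top" and "0 < t"
  shows "ennreal t * emeasure lebesgue {x. ennreal t < maximal \<nu> x}
    \<le> ennreal (weak_type_constant TYPE('n)) * emeasure \<nu> {x. ennreal t < maximal \<nu> x}"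
    (is "_ * emeasure _ ?S \<le> ennreal ?A * _")
proof -
  define n where "n = CARD('n)"
  have n: "0 < n" by (simp add: n_def)
  define K where "K = {(a :: real ^ 'n, l). 0 < l \<and> ennreal t * ennreal (l ^ n) < emeasure \<nu> (cube a l)}"
  obtain B where B: "0 \<le> B" "emeasure \<nu> UNIV = ennreal B"
    using fin by (cases "emeasure \<nu> UNIV") auto
  have S: "?S = (\<Union>(a, l)\<in>K. cube a l)"
    using \<open>0 < t\<close> by (auto simp: less_maximal_iff K_def n_def)
  have meas [measurable]: "?S \<in> sets lebesgue"
    using open_maximal_greater[OF sets] by (auto intro: lborelD borel_open)
  have rad: "0 < real n * l \<and> real n * l \<le> real n * max 1 (B / t)" if "(a, l) \<in> K" for a l
  proof -
    have l: "0 < l" and "ennreal (t * l ^ n) < emeasure \<nu> (cube a l)" using that \<open>0 < t\<close> by (auto simp: K_def ennreal_mult)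
    note this(2) also have "emeasure \<nu> (cube a l) \<le> ennreal B"
      unfolding B(2)[symmetric] using sets sets_eq_imp_space_eq[OF sets] by (intro emeasure_mono) auto
    finally have "t * l ^ n < B" using B(1) by (simp add: ennreal_less_iff l \<open>0 < t\<close> less_imp_le)
    then have *: "l ^ n < B / t" using \<open>0 < t\<close> by (simp add: field_simps)
    have "l \<le> max 1 (B / t)"
    proof (cases "l \<le> 1")
      case False
      then have "l \<le> l ^ n" using n by (intro self_le_power) auto
      with * show ?thesis by auto
    qed auto
    then show ?thesis using l n by simp
  qed
  have "?S \<subseteq> (\<Union>i\<in>K. cball (fst i) (real n * snd i))"
    unfolding S using cube_subset_cball unfolding n_def by fastforce
  then obtain C where C: "countable C" "C \<subseteq> K"
     "pairwise (\<lambda>i j. disjnt (cball (fst i) (real n * snd i)) (cball (fst j) (real n * snd j))) C"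
     "?S \<subseteq> (\<Union>i\<in>C. cball (fst i) (5 * (real n * snd i)))"
    by (rule Vitali_covering_lemma_cballs[where B = "real n * max 1 (B / t)"]) (use rad in auto)
  have disj: "disjoint_family_on (\<lambda>i. cube (fst i) (snd i)) C"
  proof (unfold disjoint_family_on_def, intro ballI impI)
    fix i j assume "i \<in> C" "j \<in> C" "i \<noteq> j"
    then have "disjnt (cball (fst i) (real n * snd i)) (cball (fst j) (real n * snd j))"
      using C(3) by (auto simp: pairwise_def)
    then show "cube (fst i) (snd i) \<inter> cube (fst j) (snd j) = {}"
      using cube_subset_cball[of "fst i" "snd i"] cube_subset_cball[of "fst j" "snd j"]
      unfolding disjnt_def n_def by blast
  qed
  have ball: "ennreal t * emeasure lebesgue (cball (fst i) (5 * (real n * snd i)))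
      \<le> ennreal ?A * emeasure \<nu> (cube (fst i) (snd i))" if "i \<in> C" for i
  proof -
    have l: "0 < snd i" and less: "ennreal (t * snd i ^ n) < emeasure \<nu> (cube (fst i) (snd i))" 
      using that C(2) \<open>0 < t\<close> by (auto simp: K_def ennreal_mult)
    let ?r = "5 * (real n * snd i)"
    have "emeasure lebesgue (cball (fst i) ?r) \<le> emeasure lebesgue (cube (fst i - (\<chi> i. ?r)) (2 * ?r))"
      by (intro emeasure_mono cball_subset_cube) auto
    also have "\<dots> = ennreal ((2 * ?r) ^ n)"
      using l n unfolding n_def by (intro emeasure_cube) auto
    also have "(2 * ?r) ^ n = ?A * snd i ^ n"
      using power_mult_distrib[of "10 * real n" "snd i" n]
      by (simp add: weak_type_constant_def n_def mult_ac)
    finally have "ennreal t * emeasure lebesgue (cball (fst i) ?r) \<le> ennreal t * ennreal (?A * snd i ^ n)"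
      by (intro mult_left_mono) auto
    also have "\<dots> = ennreal ?A * ennreal (t * snd i ^ n)"
      using l \<open>0 < t\<close> by (simp add: ennreal_mult[symmetric] weak_type_constant_def mult_ac)
    also have "\<dots> \<le> ennreal ?A * emeasure \<nu> (cube (fst i) (snd i))"
      using less by (intro mult_left_mono) auto
    finally show ?thesis .
  qed
  have "ennreal t * emeasure lebesgue ?S 
      \<le> ennreal t * emeasure lebesgue (\<Union>i\<in>C. cball (fst i) (5 * (real n * snd i)))"
    using C by (intro mult_left_mono emeasure_mono) (auto intro!: sets.countable_UN')
  also have "\<dots> \<le> ennreal t * (\<integral>\<^sup>+i. emeasure lebesgue (cball (fst i) (5 * (real n * snd i))) \<partial>count_space C)"
    using C by (intro mult_left_mono emeasure_UN_countable_le) auto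
  also have "\<dots> = (\<integral>\<^sup>+i. ennreal t * emeasure lebesgue (cball (fst i) (5 * (real n * snd i))) \<partial>count_space C)"
    by (simp add: nn_integral_cmult)
  also have "\<dots> \<le> (\<integral>\<^sup>+i. ennreal ?A * emeasure \<nu> (cube (fst i) (snd i)) \<partial>count_space C)"
    by (intro nn_integral_mono) (use ball in auto)
  also have "\<dots> = ennreal ?A * emeasure \<nu> (\<Union>i\<in>C. cube (fst i) (snd i))"
    using C disj sets by (subst emeasure_UN_countable) (auto simp: nn_integral_cmult)
  also have "\<dots> \<le> ennreal ?A * emeasure \<nu> ?S"
    using meas sets C(2) unfolding S by (intro mult_left_mono emeasure_mono) auto
  finally show ?thesis .
qed

section \<open>Averages and mean oscillation\<close>

lemma set_integrable_const_finite:
  assumes "R \<in> sets M" "emeasure M R < top"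
  shows "set_integrable M R (\<lambda>_. c :: real)"
  using assms unfolding set_integrable_def by (simp add: integrable_mult_left)

lemma average_dist_le:
  fixes f :: "real ^ 'n \<Rightarrow> real"
  assumes f: "set_integrable lebesgue R f" and R: "R \<in> sets lebesgue"
    and V: "emeasure lebesgue R = ennreal V" "0 < V"
  shows "ennreal \<bar>average f R - c\<bar> * ennreal V \<le> (\<integral>\<^sup>+x\<in>R. ennreal \<bar>f x - c\<bar> \<partial>lebesgue)"
proof -
  have V': "measure lebesgue R = V"
    using V by (simp add: measure_def)
  have c: "set_integrable lebesgue R (\<lambda>_. c)"
    using V R by (intro set_integrable_const_finite) auto
  have "(average f R - c) * V = (LINT x:R|lebesgue. f x) - (LINT x:R|lebesgue. c)"
    using V R V' by (simp add: average_def set_integral_const field_simps)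
  also have "\<dots> = (LINT x:R|lebesgue. f x - c)"
    using f c by simp
  finally have eq: "(average f R - c) * V = (LINT x:R|lebesgue. f x - c)" .
  have "ennreal \<bar>average f R - c\<bar> * ennreal V = ennreal \<bar>(average f R - c) * V\<bar>"
    using V by (simp add: ennreal_mult[symmetric] abs_mult)
  also have "\<dots> \<le> (\<integral>\<^sup>+x. norm (indicator R x *\<^sub>R (f x - c)) \<partial>lebesgue)"
    unfolding eq set_lebesgue_integral_def
    using integral_norm_bound_ennreal[OF set_integral_diff(1)[OF f c, unfolded set_integrable_def]]
    by simp
  also have "\<dots> = (\<integral>\<^sup>+x\<in>R. ennreal \<bar>f x - c\<bar> \<partial>lebesgue)"
    by (intro nn_integral_cong) (auto simp: indicator_def)
  finally show ?thesis .
qed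

lemma average_dist_cube_le:
  fixes f :: "real ^ 'n \<Rightarrow> real"
  assumes f: "set_integrable lebesgue (cube a l) f" and "0 < l"
  shows "ennreal \<bar>average f (cube a l) - c\<bar> * emeasure lebesgue (cube a l)
      \<le> (\<integral>\<^sup>+x\<in>cube a l. ennreal \<bar>f x - c\<bar> \<partial>lebesgue)"
  using average_dist_le[OF f, of "l ^ CARD('n)" c] assms by (simp add: emeasure_cube)

lemma compact_subset_cube:
  fixes K :: "(real ^ 'n) set"
  assumes "compact K" obtains a l where "0 < l" "K \<subseteq> cube a l"
proof -
  obtain r where "0 < r" "K \<subseteq> cball 0 r"
    using compact_imp_bounded[OF assms] by (auto simp: bounded_pos subset_iff dist_norm)
  with cball_subset_cube[of 0 r] show ?thesis
    by (intro that[of "2 * r" "0 - (\<chi> i. r)"]) auto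
qed

lemma locally_integrable_cubeI:
  fixes f :: "real ^ 'n \<Rightarrow> real"
  assumes "\<And>a l. 0 < l \<Longrightarrow> set_integrable lebesgue (cube a l) f"
  shows "locally_integrable f"
  unfolding locally_integrable_def
proof (intro allI impI)
  fix K :: "(real ^ 'n) set" assume "compact K"
  moreover then obtain a l where "0 < l" "K \<subseteq> cube a l" by (rule compact_subset_cube)
  moreover have "K \<in> sets lebesgue"
    using \<open>compact K\<close> by (simp add: borel_compact)
  ultimately show "set_integrable lebesgue K f"
    using set_integrable_subset[OF assms] by blast
qed

lemma locally_integrable_cubeD:
  "locally_integrable f \<Longrightarrow> set_integrable lebesgue (cube a l) f"
  by (simp add: locally_integrable_def cube_def compact_cbox)

lemma locally_integrable_measurable:
  fixes f :: "real ^ 'n \<Rightarrow> real"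
  assumes "locally_integrable f"
  shows "f \<in> borel_measurable lebesgue"
proof (rule borel_measurable_LIMSEQ_real)
  fix i :: nat
  have "set_integrable lebesgue (cball 0 (real i)) f"
    using assms by (simp add: locally_integrable_def compact_cball)
  then show "(\<lambda>x. indicator (cball 0 (real i)) x *\<^sub>R f x) \<in> borel_measurable lebesgue"
    unfolding set_integrable_def by (rule borel_measurable_integrable)
next
  fix x :: "real ^ 'n"
  obtain N where "norm x \<le> real N" using real_arch_simple by blast
  then have "\<forall>i\<ge>N. f x = indicator (cball 0 (real i)) x *\<^sub>R f x"
    by (auto simp: indicator_def)
  then show "(\<lambda>i. indicator (cball 0 (real i)) x *\<^sub>R f x) \<longlonglongrightarrow> f x"
    by (intro tendsto_eventually) (auto simp: eventually_sequentially)
qed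

text \<open>Oscillation may be measured against an arbitrary constant on each cube, at the price of a factor 2, because the
  average is then close to that constant.\<close>

lemma BMO_norm_leI:
  fixes f :: "real ^ 'n \<Rightarrow> real"
  assumes meas [measurable]: "f \<in> borel_measurable lebesgue"
    and osc: "\<And>a l. 0 < l \<Longrightarrow>
      \<exists>c. (\<integral>\<^sup>+x\<in>cube a l. ennreal \<bar>f x - c\<bar> \<partial>lebesgue) \<le> ennreal K * emeasure lebesgue (cube a l)"
  shows "locally_integrable f" "BMO_norm f \<le> ennreal (2 * K)"
proof -
  have int: "set_integrable lebesgue (cube a l) f" if l: "0 < l" for a l
  proof -
    obtain c where c: "(\<integral>\<^sup>+x\<in>cube a l. ennreal \<bar>f x - c\<bar> \<partial>lebesgue) \<le> ennreal K * emeasure lebesgue (cube a l)"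
      using osc[OF l] by blast
    have "set_integrable lebesgue (cube a l) (\<lambda>x. f x - c)"
      unfolding set_integrable_def
    proof (rule integrableI_bounded)
      have "(\<integral>\<^sup>+x. ennreal (norm (indicator (cube a l) x *\<^sub>R (f x - c))) \<partial>lebesgue)
          = (\<integral>\<^sup>+x\<in>cube a l. ennreal \<bar>f x - c\<bar> \<partial>lebesgue)"
        by (intro nn_integral_cong) (auto simp: indicator_def)
      also have "\<dots> \<le> ennreal K * emeasure lebesgue (cube a l)" by (rule c)
      also have "\<dots> < \<infinity>" using l by (simp add: emeasure_cube ennreal_mult_less_top)
      finally show "(\<integral>\<^sup>+x. ennreal (norm (indicator (cube a l) x *\<^sub>R (f x - c))) \<partial>lebesgue) < \<infinity>" .
    qed measurable
    moreover have "set_integrable lebesgue (cube a l) (\<lambda>_. c)"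
      using l by (intro set_integrable_const_finite) (auto simp: emeasure_cube)
    ultimately have "set_integrable lebesgue (cube a l) (\<lambda>x. (f x - c) + c)"
      by (rule set_integral_add)
    then show ?thesis by simp
  qed
  then show "locally_integrable f" by (rule locally_integrable_cubeI)
  show "BMO_norm f \<le> ennreal (2 * K)"
    unfolding BMO_norm_def
  proof (rule SUP_least, elim cubesE, clarify)
    fix a :: "real ^ 'n" and l :: real assume l: "0 < l"
    let ?Q = "cube a l"
    obtain c where c: "(\<integral>\<^sup>+x\<in>?Q. ennreal \<bar>f x - c\<bar> \<partial>lebesgue) \<le> ennreal K * emeasure lebesgue ?Q"
      using osc[OF l] by blast
    have "(\<integral>\<^sup>+x\<in>?Q. ennreal \<bar>f x - average f ?Q\<bar> \<partial>lebesgue)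
        \<le> (\<integral>\<^sup>+x. ennreal \<bar>f x - c\<bar> * indicator ?Q x + ennreal \<bar>average f ?Q - c\<bar> * indicator ?Q x \<partial>lebesgue)"
      by (intro nn_integral_mono) (auto simp: indicator_def ennreal_plus[symmetric] simp del: ennreal_plus)
    also have "\<dots> = (\<integral>\<^sup>+x\<in>?Q. ennreal \<bar>f x - c\<bar> \<partial>lebesgue) + ennreal \<bar>average f ?Q - c\<bar> * emeasure lebesgue ?Q"
      by (subst nn_integral_add) (auto simp: nn_integral_cmult)
    also have "\<dots> \<le> ennreal K * emeasure lebesgue ?Q + ennreal K * emeasure lebesgue ?Q"
      using average_dist_cube_le[OF int[OF l] l, of a c] c by (intro add_mono) (auto intro: order_trans)
    also have "\<dots> = ennreal (2 * K) * emeasure lebesgue ?Q"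
    proof -
      have "ennreal (2 * K) = ennreal K + ennreal K"
        by (cases "0 \<le> K") (auto simp: ennreal_neg ennreal_plus[symmetric] simp del: ennreal_plus)
      then show ?thesis by (simp add: distrib_right)
    qed
    finally show "(\<integral>\<^sup>+x\<in>?Q. ennreal \<bar>f x - average f ?Q\<bar> \<partial>lebesgue) / emeasure lebesgue ?Q \<le> ennreal (2 * K)"
      using l by (intro divide_le_posI_ennreal) (auto simp: emeasure_cube mult_ac)
  qed
qed

lemma BMO_normD:
  fixes f :: "real ^ 'n \<Rightarrow> real"
  assumes "0 < l" "BMO_norm f \<le> K"
  shows "(\<integral>\<^sup>+x\<in>cube a l. ennreal \<bar>f x - average f (cube a l)\<bar> \<partial>lebesgue) \<le> K * emeasure lebesgue (cube a l)"
proof -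
  let ?I = "\<integral>\<^sup>+x\<in>cube a l. ennreal \<bar>f x - average f (cube a l)\<bar> \<partial>lebesgue"
  have "?I / emeasure lebesgue (cube a l) \<le> BMO_norm f"
    unfolding BMO_norm_def using assms(1) by (intro SUP_upper) auto
  also note assms(2)
  finally have "\<not> K < ?I / emeasure lebesgue (cube a l)" by simp
  then show ?thesis
    using assms(1) by (subst (asm) less_divide_ennreal_iff) (auto simp: emeasure_cube)
qed

section \<open>A function of bounded mean oscillation that counts levels of the maximal function\<close>

text \<open>A discrete form of the positive part of \<open>log\<^sub>2 (maximal \<nu> x / \<tau>)\<close>. Counting levels
  turns every estimate of a logarithm into a sum of weak type estimates, one for each level.\<close>

definition level_count :: "(real ^ 'n) measure \<Rightarrow> real \<Rightarrow> real ^ 'n \<Rightarrow> ennreal" where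
  "level_count \<nu> \<tau> x = (\<Sum>k. indicator {y. ennreal (2 ^ k * \<tau>) < maximal \<nu> y} x)"

lemma suminf_split_ennreal:
  fixes f :: "nat \<Rightarrow> ennreal"
  shows "(\<Sum>k. f k) = (\<Sum>k<j. f k) + (\<Sum>k. f (k + j))"
proof (induction j)
  case (Suc j)
  have "(\<lambda>k. f (Suc k + j)) sums (\<Sum>k. f (Suc k + j))"
    by (intro summable_sums summableI)
  from sums_Suc[of "\<lambda>k. f (k + j)", OF this] have "(\<Sum>k. f (k + j)) = (\<Sum>k. f (Suc k + j)) + f (0 + j)"
    by (rule sums_unique[symmetric])
  with Suc show ?case by (simp add: add_ac)
qed simp

text \<open>If the levels \<open>\<tau>, 2\<tau>, \<dots>, 2\<^sup>m\<^sup>-\<^sup>1\<tau>\<close> are the ones below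
  \<open>t\<close>, they add up to \<open>2\<^sup>m\<tau> - \<tau>\<close>, and \<open>2\<^sup>m\<tau>\<close> is
  at least \<open>t\<close>. If all levels are below \<open>t\<close>, their sum is infinite.\<close>

lemma le_sum_exceeded_levels:
  fixes t :: ennreal
  assumes "0 < \<tau>"
  shows "t \<le> ennreal \<tau> + (\<Sum>k. ennreal (2 ^ k * \<tau>) * (if ennreal (2 ^ k * \<tau>) < t then 1 else 0))"
    (is "_ \<le> _ + (\<Sum>k. ?f k)")
proof -
  have partial: "ennreal (2 ^ m * \<tau>) \<le> ennreal \<tau> + (\<Sum>k. ?f k)"
    if "\<And>k. k < m \<Longrightarrow> ennreal (2 ^ k * \<tau>) < t" for m
  proof -
    have "(2 :: real) ^ m = 1 + (\<Sum>k<m. 2 ^ k)"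
      by (induction m) auto
    then have "2 ^ m * \<tau> = \<tau> + (\<Sum>k<m. 2 ^ k * \<tau>)"
      by (simp add: distrib_right sum_distrib_right)
    then have "ennreal (2 ^ m * \<tau>) = ennreal \<tau> + (\<Sum>k<m. ennreal (2 ^ k * \<tau>))"
      using assms by (simp add: sum_nonneg)
    also have "(\<Sum>k<m. ennreal (2 ^ k * \<tau>)) = (\<Sum>k<m. ?f k)"
      using that by (intro sum.cong) auto
    also have "\<dots> \<le> (\<Sum>k. ?f k)"
      by (intro sum_le_suminf) auto
    finally show ?thesis by simp
  qed
  show ?thesis
  proof (cases "\<exists>m. t \<le> ennreal (2 ^ m * \<tau>)")
    case True
    define m where "m = (LEAST m. t \<le> ennreal (2 ^ m * \<tau>))"
    have "t \<le> ennreal (2 ^ m * \<tau>)"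
      using True unfolding m_def by (rule LeastI_ex)
    also have "\<dots> \<le> ennreal \<tau> + (\<Sum>k. ?f k)"
      using not_less_Least[of _ "\<lambda>m. t \<le> ennreal (2 ^ m * \<tau>)"] unfolding m_def[symmetric]
      by (intro partial) (auto simp: not_le)
    finally show ?thesis .
  next
    case False
    then have *: "ennreal (2 ^ m * \<tau>) \<le> ennreal \<tau> + (\<Sum>k. ?f k)" for m
      by (intro partial) (auto simp: not_le)
    have "ennreal \<tau> + (\<Sum>k. ?f k) = top"
    proof (rule ccontr)
      assume "ennreal \<tau> + (\<Sum>k. ?f k) \<noteq> top"
      then obtain r where r: "0 \<le> r" "ennreal \<tau> + (\<Sum>k. ?f k) = ennreal r"
        by (cases "ennreal \<tau> + (\<Sum>k. ?f k)") auto
      obtain m where "r / \<tau> < 2 ^ m"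
        using real_arch_pow[of 2] by auto
      then have "r < 2 ^ m * \<tau>"
        using assms by (simp add: field_simps)
      with *[of m] r show False
        by (simp add: ennreal_le_iff2 not_le[symmetric])
    qed
    then show ?thesis by (metis top_greatest)
  qed
qed

lemma level_count_infinite:
  assumes "\<And>k. ennreal (2 ^ k * \<tau>) < maximal \<nu> x"
  shows "level_count \<nu> \<tau> x = top"
proof -
  have "(\<Sum>k::nat. 1 :: ennreal) = top"
  proof (rule ccontr)
    assume "(\<Sum>k::nat. 1 :: ennreal) \<noteq> top"
    then obtain r where r: "0 \<le> r" "(\<Sum>k::nat. 1 :: ennreal) = ennreal r"
      by (cases "\<Sum>k::nat. 1 :: ennreal") auto
    obtain m where "r < real m" using reals_Archimedean2 by blast
    moreover have "(\<Sum>k<m. 1 :: ennreal) \<le> (\<Sum>k. 1)"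
      by (intro sum_le_suminf) auto
    ultimately show False
      using r by (simp add: ennreal_of_nat_eq_real_of_nat)
  qed
  then show ?thesis using assms by (simp add: level_count_def indicator_def)
qed

context
  fixes \<nu> :: "(real ^ 'n) measure"
  assumes sets: "sets \<nu> = sets lebesgue"
begin

lemma sets_level [measurable, simp]: "{x. t < maximal \<nu> x} \<in> sets lebesgue"
  using open_maximal_greater[OF sets] by (auto intro: borel_open)

lemma borel_measurable_maximal [measurable]: "maximal \<nu> \<in> borel_measurable lebesgue"
  by (rule borel_measurableI_greater) simp

lemma borel_measurable_level_count [measurable]: "level_count \<nu> \<tau> \<in> borel_measurable lebesgue"
proof -
  have "(\<lambda>x. \<Sum>k. indicator {y. ennreal (2 ^ k * \<tau>) < maximal \<nu> y} x :: ennreal) \<in> borel_measurable lebesgue"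
    by (intro borel_measurable_suminf_order borel_measurable_indicator) simp
  then show ?thesis by (simp add: level_count_def[abs_def])
qed

end

text \<open>The weak type bounds at the levels \<open>2\<^sup>k\<tau>\<close> form a geometric series.\<close>

lemma nn_integral_level_count_le:
  fixes \<nu> :: "(real ^ 'n) measure"
  assumes sets: "sets \<nu> = sets lebesgue" and fin: "emeasure \<nu> UNIV < top"
    and "0 < \<tau>" and B: "0 \<le> B" "emeasure \<nu> UNIV \<le> ennreal B"
  shows "(\<integral>\<^sup>+x. level_count \<nu> \<tau> x \<partial>lebesgue) \<le> ennreal (2 * weak_type_constant TYPE('n) * B / \<tau>)"
proof -
  let ?A = "weak_type_constant TYPE('n)"
  have A: "0 \<le> ?A" by (simp add: weak_type_constant_def)
  note [measurable] = sets_level[OF sets]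
  have level: "emeasure lebesgue {y. ennreal (2 ^ k * \<tau>) < maximal \<nu> y} \<le> ennreal ((?A * B / \<tau>) * (1 / 2) ^ k)" for k
  proof -
    let ?t = "2 ^ k * \<tau>" and ?S = "{y. ennreal (2 ^ k * \<tau>) < maximal \<nu> y}"
    have t: "0 < ?t" using assms by simp
    have "ennreal ?t * emeasure lebesgue ?S \<le> ennreal ?A * emeasure \<nu> ?S"
      by (rule maximal_weak_type[OF sets fin t])
    also have "\<dots> \<le> ennreal ?A * emeasure \<nu> UNIV"
      using sets sets_eq_imp_space_eq[OF sets] by (intro mult_left_mono emeasure_mono) auto
    also have "\<dots> \<le> ennreal ?A * ennreal B"
      using B by (intro mult_left_mono) auto
    also have "\<dots> = ennreal ?t * ennreal ((?A * B / \<tau>) * (1 / 2) ^ k)"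
      using A B assms by (simp add: ennreal_mult[symmetric] power_one_over)
    finally show ?thesis
      using t by (subst (asm) ennreal_mult_le_mult_iff) auto
  qed
  have "(\<integral>\<^sup>+x. level_count \<nu> \<tau> x \<partial>lebesgue)
      = (\<Sum>k. emeasure lebesgue {y. ennreal (2 ^ k * \<tau>) < maximal \<nu> y})"
    unfolding level_count_def by (subst nn_integral_suminf) auto
  also have "\<dots> \<le> (\<Sum>k. ennreal ((?A * B / \<tau>) * (1 / 2) ^ k))"
    by (intro suminf_le level) auto
  also have "\<dots> = ennreal ((?A * B / \<tau>) * 2)"
    using A B assms sums_mult[OF geometric_sums[of "1 / 2 :: real"], of "?A * B / \<tau>"]
    by (intro suminf_ennreal_eq) auto
  finally show ?thesis by (simp add: mult_ac)
qed

lemma AE_level_count_finite: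
  fixes \<nu> :: "(real ^ 'n) measure"
  assumes sets: "sets \<nu> = sets lebesgue" and fin: "emeasure \<nu> UNIV < top"
    and "0 < \<tau>" shows "AE x in lebesgue. level_count \<nu> \<tau> x \<noteq> top"
proof -
  obtain B where "0 \<le> B" "emeasure \<nu> UNIV = ennreal B"
    using fin by (cases "emeasure \<nu> UNIV") auto
  then have "(\<integral>\<^sup>+x. level_count \<nu> \<tau> x \<partial>lebesgue) \<noteq> top"
    using nn_integral_level_count_le[OF assms, of B] by (auto simp: top_unique)
  then show ?thesis
    using nn_integral_PInf_AE[OF borel_measurable_level_count[OF sets]] by auto
qed

text \<open>The level count has bounded mean oscillation, with a bound that depends on the dimension alone. On a cube
  \<open>R\<close> let \<open>j\<close> be the least value of the count. Apart from the next \<open>2n\<close>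
  levels, only the mass within the threefold enlargement of \<open>R\<close> matters for the levels above
  \<open>j\<close>: a cube that meets \<open>R\<close> and leaves the enlargement is at least as large as
  \<open>R\<close>, so its own threefold enlargement contains the point of \<open>R\<close> at which the count is
  \<open>j\<close>, and this bounds its average by \<open>3\<^sup>n 2\<^sup>j\<tau>\<close>. The mass of the
  enlargement of \<open>R\<close> is bounded for the same reason, and \<open>nn_integral_level_count_le\<close>
  controls the levels that this mass produces.\<close>

lemma level_count_oscillation:
  fixes \<nu> :: "(real ^ 'n) measure"
  assumes sets: "sets \<nu> = sets lebesgue" and fin: "emeasure \<nu> UNIV < top"
    and "0 < \<tau>" and l: "0 < l"
  shows "\<exists>c. (\<integral>\<^sup>+x\<in>cube a l. ennreal \<bar>enn2real (level_count \<nu> \<tau> x) - c\<bar> \<partial>lebesgue)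
    \<le> ennreal (2 * CARD('n) + 2 * weak_type_constant TYPE('n) * 3 ^ CARD('n)) * emeasure lebesgue (cube a l)"
proof -
  define n where "n = CARD('n)"
  let ?A = "weak_type_constant TYPE('n)" and ?R = "cube a l"
  let ?R3 = "cube (a - (\<chi> i. l)) (3 * l)"
  have A: "0 \<le> ?A" by (simp add: weak_type_constant_def)
  have nu_space: "space \<nu> = UNIV" using sets_eq_imp_space_eq[OF sets] by simp
  have "\<exists>x\<in>?R. level_count \<nu> \<tau> x \<noteq> top"
  proof (rule ccontr)
    assume "\<not> ?thesis"
    then have "AE x in lebesgue. x \<notin> ?R"
      using AE_level_count_finite[OF sets fin \<open>0 < \<tau>\<close>] by (auto elim!: eventually_mono)
    then have "emeasure lebesgue ?R = 0"
      by (subst (asm) AE_iff_measurable[of ?R]) auto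
    then show False using l by (simp add: emeasure_cube)
  qed
  then have ex: "\<exists>k. \<exists>x\<in>?R. maximal \<nu> x \<le> ennreal (2 ^ k * \<tau>)"
    using level_count_infinite by (metis not_le)
  define j where "j = (LEAST k. \<exists>x\<in>?R. maximal \<nu> x \<le> ennreal (2 ^ k * \<tau>))"
  define \<tau>' where "\<tau>' = 2 ^ j * \<tau>"
  have \<tau>': "0 < \<tau>'" using assms by (simp add: \<tau>'_def)
  obtain x0 where x0: "x0 \<in> ?R" "maximal \<nu> x0 \<le> ennreal \<tau>'"
    using LeastI_ex[OF ex] by (auto simp: j_def \<tau>'_def)
  have below: "ennreal (2 ^ k * \<tau>) < maximal \<nu> x" if "k < j" "x \<in> ?R" for k x
    using not_less_Least[OF that(1)[unfolded j_def]] that(2) by (auto simp: not_le)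
  have mass: "emeasure \<nu> (cube b m) \<le> ennreal (\<tau>' * m ^ n)" if "0 < m" "x0 \<in> cube b m" for b m
  proof (rule ccontr)
    assume "\<not> ?thesis"
    then have "ennreal \<tau>' < maximal \<nu> x0"
      using that \<tau>' unfolding less_maximal_iff n_def by (auto simp: ennreal_mult not_le)
    with x0 show False by simp
  qed
  \<comment> \<open>the mass near \<open>?R\<close>; it determines the levels well above the least count \<open>j\<close>\<close>
  define \<mu> where "\<mu> = density \<nu> (indicator ?R3)"
  have sets_\<mu>: "sets \<mu> = sets lebesgue" by (simp add: \<mu>_def sets)
  have emeasure_\<mu>: "emeasure \<mu> X = emeasure \<nu> (?R3 \<inter> X)" if "X \<in> sets lebesgue" for X
    unfolding \<mu>_def using that by (intro emeasure_restricted) (auto simp: sets)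
  have R_R3: "y \<in> ?R3" if "y \<in> ?R" for y
  proof -
    have "a $ i \<le> y $ i \<and> y $ i \<le> a $ i + l" for i using that by (simp add: mem_cube)
    then have "a $ i - l \<le> y $ i \<and> y $ i \<le> a $ i - l + 3 * l" for i using l by (smt (verit, best))
    then show ?thesis by (simp add: mem_cube)
  qed
  have \<mu>_UNIV: "emeasure \<mu> UNIV \<le> ennreal (\<tau>' * (3 * l) ^ n)"
    using mass[OF _ R_R3[OF x0(1)]] l emeasure_\<mu>[of UNIV] by simp
  have fin_\<mu>: "emeasure \<mu> UNIV < top"
    using \<mu>_UNIV by (rule le_less_trans) simp
  \<comment> \<open>\<open>2\<^sup>2\<^sup>n = 4\<^sup>n\<close> absorbs the factor \<open>3\<^sup>n\<close> by which a threefold enlargement increases the volume\<close>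
  have above: "ennreal (2 ^ k * \<tau>') < maximal \<mu> x"
    if k: "2 * n \<le> k" and x: "x \<in> ?R" and less: "ennreal (2 ^ k * \<tau>') < maximal \<nu> x" for k x
  proof -
    obtain b m where bm: "0 < m" "x \<in> cube b m" "ennreal (2 ^ k * \<tau>') * ennreal (m ^ n) < emeasure \<nu> (cube b m)"
      using less unfolding less_maximal_iff n_def by blast
    have "cube b m \<subseteq> ?R3"
    proof (rule ccontr)
      assume "\<not> ?thesis"
      then obtain y where y: "y \<in> cube b m" "y \<notin> ?R3" by blast
      then obtain i where i: "y $ i < a $ i - l \<or> a $ i - l + 3 * l < y $ i"
        by (force simp: mem_cube not_le)
      have "l < m"
      proof -
        have "a $ i \<le> x $ i \<and> x $ i \<le> a $ i + l" "b $ i \<le> x $ i \<and> x $ i \<le> b $ i + m"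
          "b $ i \<le> y $ i \<and> y $ i \<le> b $ i + m"
          using x bm y by (simp_all add: mem_cube)
        with i show ?thesis by linarith
      qed
      have x0': "x0 \<in> cube (b - (\<chi> i. m)) (3 * m)"
      proof -
        have "a $ i \<le> x $ i \<and> x $ i \<le> a $ i + l" "b $ i \<le> x $ i \<and> x $ i \<le> b $ i + m"
          "a $ i \<le> x0 $ i \<and> x0 $ i \<le> a $ i + l" for i
          using x bm x0 by (simp_all add: mem_cube)
        with \<open>l < m\<close> have "b $ i - m \<le> x0 $ i \<and> x0 $ i \<le> b $ i - m + 3 * m" for i
          by (smt (verit, best))
        then show ?thesis by (simp add: mem_cube)
      qed
      have "cube b m \<subseteq> cube (b - (\<chi> i. m)) (3 * m)"
      proof
        fix z assume "z \<in> cube b m"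
        then have "b $ i \<le> z $ i \<and> z $ i \<le> b $ i + m" for i by (simp add: mem_cube)
        then have "b $ i - m \<le> z $ i \<and> z $ i \<le> b $ i - m + 3 * m" for i
          using bm(1) by (smt (verit, best))
        then show "z \<in> cube (b - (\<chi> i. m)) (3 * m)" by (simp add: mem_cube)
      qed
      then have "emeasure \<nu> (cube b m) \<le> emeasure \<nu> (cube (b - (\<chi> i. m)) (3 * m))"
        by (intro emeasure_mono) (auto simp: sets)
      also have "\<dots> \<le> ennreal (\<tau>' * (3 * m) ^ n)"
        using bm(1) by (intro mass x0') auto
      also have "\<dots> \<le> ennreal (2 ^ k * \<tau>' * m ^ n)"
      proof (rule ennreal_leI)
        have "(3 :: real) ^ n \<le> 4 ^ n" by (rule power_mono) auto
        also have "(4 :: real) ^ n = 2 ^ (2 * n)" by (simp add: power_mult)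
        also have "\<dots> \<le> 2 ^ k" using k by (intro power_increasing) auto
        finally have "3 ^ n * (\<tau>' * m ^ n) \<le> 2 ^ k * (\<tau>' * m ^ n)"
          using \<tau>' bm(1) by (intro mult_right_mono) auto
        then show "\<tau>' * (3 * m) ^ n \<le> 2 ^ k * \<tau>' * m ^ n"
          by (simp add: power_mult_distrib mult_ac)
      qed
      also have "\<dots> = ennreal (2 ^ k * \<tau>') * ennreal (m ^ n)"
        using \<tau>' bm(1) by (simp add: ennreal_mult)
      finally show False using bm(3) by simp
    qed
    then have "emeasure \<mu> (cube b m) = emeasure \<nu> (cube b m)"
      by (simp add: emeasure_\<mu> Int_absorb1)
    with bm show ?thesis unfolding less_maximal_iff n_def by metis
  qed
  define r where "r x = (\<Sum>k. indicator {y. ennreal (2 ^ (k + j) * \<tau>) < maximal \<nu> y} x :: ennreal)" for x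
  have split: "level_count \<nu> \<tau> x = of_nat j + r x" if "x \<in> ?R" for x
  proof -
    have "(\<Sum>k<j. indicator {y. ennreal (2 ^ k * \<tau>) < maximal \<nu> y} x) = (of_nat j :: ennreal)"
      using below that by (simp add: indicator_def)
    then show ?thesis
      unfolding level_count_def r_def by (subst suminf_split_ennreal[of _ j]) simp
  qed
  have r_le: "r x \<le> of_nat (2 * n) + level_count \<mu> \<tau>' x" if x: "x \<in> ?R" for x
  proof -
    let ?i = "\<lambda>k. indicator {y. ennreal (2 ^ k * \<tau>') < maximal \<nu> y} x :: ennreal"
    have "r x = (\<Sum>k. ?i k)"
      by (simp add: r_def \<tau>'_def power_add mult_ac)
    also have "\<dots> = (\<Sum>k<2 * n. ?i k) + (\<Sum>k. ?i (k + 2 * n))"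
      by (rule suminf_split_ennreal)
    also have "\<dots> \<le> (\<Sum>k<2 * n. 1) + (\<Sum>k. indicator {y. ennreal (2 ^ (k + 2 * n) * \<tau>') < maximal \<mu> y} x)"
      using above x by (intro add_mono sum_mono suminf_le) (auto simp: indicator_def)
    also have "(\<Sum>k. indicator {y. ennreal (2 ^ (k + 2 * n) * \<tau>') < maximal \<mu> y} x) \<le> level_count \<mu> \<tau>' x"
      unfolding level_count_def by (subst (2) suminf_split_ennreal[of _ "2 * n"]) simp
    finally show ?thesis by (simp add: add_mono)
  qed
  have "(\<integral>\<^sup>+x\<in>?R. ennreal \<bar>enn2real (level_count \<nu> \<tau> x) - real j\<bar> \<partial>lebesgue) \<le> (\<integral>\<^sup>+x\<in>?R. r x \<partial>lebesgue)"
  proof (intro nn_integral_mono_AE)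
    show "AE x in lebesgue. ennreal \<bar>enn2real (level_count \<nu> \<tau> x) - real j\<bar> * indicator ?R x \<le> r x * indicator ?R x"
      using AE_level_count_finite[OF sets fin \<open>0 < \<tau>\<close>]
    proof eventually_elim
      case (elim x)
      show ?case
      proof (cases "x \<in> ?R")
        case True
        with elim split obtain q where "0 \<le> q" "r x = ennreal q"
          by (cases "r x") auto
        with split[OF True] have "level_count \<nu> \<tau> x = ennreal (real j + q)"
          by (simp add: ennreal_of_nat_eq_real_of_nat)
        then have "enn2real (level_count \<nu> \<tau> x) = real j + q"
          using \<open>0 \<le> q\<close> by (simp del: ennreal_plus)
        with \<open>0 \<le> q\<close> \<open>r x = ennreal q\<close> show ?thesis by (simp add: indicator_def)
      qed simp
    qed
  qed
  also have "\<dots> \<le> (\<integral>\<^sup>+x. of_nat (2 * n) * indicator ?R x + level_count \<mu> \<tau>' x \<partial>lebesgue)"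
    using r_le by (intro nn_integral_mono) (auto simp: indicator_def)
  also have "\<dots> = of_nat (2 * n) * emeasure lebesgue ?R + (\<integral>\<^sup>+x. level_count \<mu> \<tau>' x \<partial>lebesgue)"
    using borel_measurable_level_count[OF sets_\<mu>]
    by (subst nn_integral_add) (auto simp: nn_integral_cmult_indicator simp del: of_nat_mult)
  also have "\<dots> \<le> of_nat (2 * n) * emeasure lebesgue ?R + ennreal (2 * ?A * (\<tau>' * (3 * l) ^ n) / \<tau>')"
    using \<tau>' l \<mu>_UNIV by (intro add_left_mono nn_integral_level_count_le[OF sets_\<mu> fin_\<mu> \<tau>']) auto
  also have "2 * ?A * (\<tau>' * (3 * l) ^ n) / \<tau>' = (2 * ?A * 3 ^ n) * l ^ n"
    using \<tau>' by (simp add: power_mult_distrib)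
  also have "of_nat (2 * n) * emeasure lebesgue ?R + ennreal ((2 * ?A * 3 ^ n) * l ^ n)
      = ennreal (2 * n + 2 * ?A * 3 ^ n) * emeasure lebesgue ?R"
  proof -
    have "ennreal (2 * n + 2 * ?A * 3 ^ n) = of_nat (2 * n) + ennreal (2 * ?A * 3 ^ n)"
      using A by (subst ennreal_plus) (auto simp: ennreal_of_nat_eq_real_of_nat)
    moreover have "ennreal ((2 * ?A * 3 ^ n) * l ^ n) = ennreal (2 * ?A * 3 ^ n) * emeasure lebesgue ?R"
      using A l by (subst ennreal_mult) (auto simp: emeasure_cube n_def)
    ultimately show ?thesis by (simp only: distrib_right)
  qed
  finally show ?thesis unfolding n_def by blast
qed

text \<open>The \<open>L log L\<close> bound for the maximal function: the weak type estimates at the levels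
  \<open>2\<^sup>k\<tau>\<close>, weighted by \<open>2\<^sup>k\<tau>\<close>, add up to the integral of the
  maximal function on the left and to the number of levels on the right.\<close>

lemma nn_integral_maximal_le_level_count:
  fixes \<nu> :: "(real ^ 'n) measure"
  assumes sets: "sets \<nu> = sets lebesgue" and fin: "emeasure \<nu> UNIV < top"
    and "0 < \<tau>" and X [measurable]: "X \<in> sets lebesgue"
  shows "(\<integral>\<^sup>+x\<in>X. maximal \<nu> x \<partial>lebesgue) \<le> ennreal \<tau> * emeasure lebesgue X
    + ennreal (weak_type_constant TYPE('n)) * (\<integral>\<^sup>+x. level_count \<nu> \<tau> x \<partial>\<nu>)"
proof -
  let ?A = "weak_type_constant TYPE('n)"
  let ?S = "\<lambda>k. {y. ennreal (2 ^ k * \<tau>) < maximal \<nu> y}"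
  have S [measurable]: "?S k \<in> sets lebesgue" for k by (rule sets_level[OF sets])
  have "(\<integral>\<^sup>+x\<in>X. maximal \<nu> x \<partial>lebesgue)
      \<le> (\<integral>\<^sup>+x. ennreal \<tau> * indicator X x + (\<Sum>k. ennreal (2 ^ k * \<tau>) * indicator (?S k) x) \<partial>lebesgue)"
  proof (intro nn_integral_mono)
    fix x
    show "maximal \<nu> x * indicator X x \<le> ennreal \<tau> * indicator X x + (\<Sum>k. ennreal (2 ^ k * \<tau>) * indicator (?S k) x)"
      using le_sum_exceeded_levels[OF \<open>0 < \<tau>\<close>, of "maximal \<nu> x"]
      by (cases "x \<in> X") (simp_all add: indicator_def of_bool_def)
  qed
  also have "\<dots> = ennreal \<tau> * emeasure lebesgue X + (\<Sum>k. ennreal (2 ^ k * \<tau>) * emeasure lebesgue (?S k))"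
    by (simp add: nn_integral_add nn_integral_suminf nn_integral_cmult_indicator)
  also have "\<dots> \<le> ennreal \<tau> * emeasure lebesgue X + (\<Sum>k. ennreal ?A * emeasure \<nu> (?S k))"
    using \<open>0 < \<tau>\<close> by (intro add_left_mono suminf_le maximal_weak_type[OF sets fin]) auto
  also have "(\<Sum>k. ennreal ?A * emeasure \<nu> (?S k)) = ennreal ?A * (\<integral>\<^sup>+x. level_count \<nu> \<tau> x \<partial>\<nu>)"
  proof -
    have S': "?S k \<in> sets \<nu>" for k using S sets by simp
    show ?thesis unfolding level_count_def using S'
      by (subst nn_integral_suminf) auto
  qed
  finally show ?thesis .
qed

section \<open>The lower bound\<close>

lemma average_cmult:
  "average (\<lambda>x. c * f x) Q = c * average f Q"
  by (simp add: average_def)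

lemma BMO_norm_cmult:
  fixes f :: "real ^ 'n \<Rightarrow> real"
  assumes c: "0 \<le> c" and [measurable]: "f \<in> borel_measurable lebesgue"
  shows "BMO_norm (\<lambda>x. c * f x) = ennreal c * BMO_norm f"
proof -
  have "(\<integral>\<^sup>+x\<in>Q. ennreal \<bar>c * f x - average (\<lambda>x. c * f x) Q\<bar> \<partial>lebesgue) / emeasure lebesgue Q
      = ennreal c * ((\<integral>\<^sup>+x\<in>Q. ennreal \<bar>f x - average f Q\<bar> \<partial>lebesgue) / emeasure lebesgue Q)"
    if "Q \<in> cubes" for Q :: "(real ^ 'n) set"
  proof -
    have [measurable]: "Q \<in> sets lebesgue" using that by (auto elim: cubesE)
    have "(\<integral>\<^sup>+x\<in>Q. ennreal \<bar>c * f x - average (\<lambda>x. c * f x) Q\<bar> \<partial>lebesgue)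
        = (\<integral>\<^sup>+x. ennreal c * (ennreal \<bar>f x - average f Q\<bar> * indicator Q x) \<partial>lebesgue)"
      using c by (intro nn_integral_cong)
        (simp add: average_cmult right_diff_distrib[symmetric] abs_mult ennreal_mult mult_ac)
    also have "\<dots> = ennreal c * (\<integral>\<^sup>+x\<in>Q. ennreal \<bar>f x - average f Q\<bar> \<partial>lebesgue)"
      by (intro nn_integral_cmult) measurable
    finally show ?thesis by (simp add: ennreal_times_divide)
  qed
  then show ?thesis
    unfolding BMO_norm_def by (simp add: SUP_mult_left_ennreal cong: SUP_cong)
qed

text \<open>Test functions of norm at most \<open>K\<close> are as good as functions of norm 1. A function of norm 0 is
  constant almost everywhere on each cube and contributes nothing; every other one can be normalised.\<close>

lemma weighted_oscillation_le_SUP: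
  fixes f v :: "real ^ 'n \<Rightarrow> real"
  assumes v: "weight v" and f: "locally_integrable f" "BMO_norm f \<le> ennreal K"
    and Q: "Q \<in> cubes" and Y: "0 < Y Q"
  shows "(\<integral>\<^sup>+x\<in>Q. ennreal (\<bar>f x - average f Q\<bar> * v x) \<partial>lebesgue) / ennreal (Y Q)
    \<le> ennreal K * (SUP b\<in>{b. locally_integrable b \<and> BMO_norm b = 1}. weighted_BMO_norm v Y b)"
    (is "?I f / _ \<le> _ * ?S")
proof -
  note [measurable] = locally_integrable_measurable[OF f(1)]
  have [measurable]: "Q \<in> sets lebesgue" using Q by (auto elim: cubesE)
  have v_meas [measurable]: "v \<in> borel_measurable lebesgue" and v_nonneg: "0 \<le> v x" for x
    using v by (auto simp: weight_def intro: locally_integrable_measurable)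
  obtain N where N: "0 \<le> N" "BMO_norm f = ennreal N"
    using f(2) by (cases "BMO_norm f") (auto simp: top_unique)
  show ?thesis
  proof (cases "N = 0")
    case True
    obtain a l where Q': "Q = cube a l" "0 < l" using Q by (auto elim: cubesE)
    have "(\<integral>\<^sup>+x\<in>Q. ennreal \<bar>f x - average f Q\<bar> \<partial>lebesgue) = 0"
      using BMO_normD[OF Q'(2), of f 0 a] N True Q' by simp
    then have "AE x in lebesgue. ennreal \<bar>f x - average f Q\<bar> * indicator Q x = 0"
      by (subst (asm) nn_integral_0_iff_AE) auto
    then have "?I f = (\<integral>\<^sup>+x. 0 \<partial>(lebesgue :: (real ^ 'n) measure))"
      by (intro nn_integral_cong_AE) (auto elim!: eventually_mono simp: indicator_def split: if_splits)
    then show ?thesis by simp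
  next
    case False
    with N have N_pos: "0 < N" by simp
    define g where "g = (\<lambda>x. (1 / N) * f x)"
    have g: "locally_integrable g" "BMO_norm g = 1"
    proof -
      show "locally_integrable g"
        using f(1) unfolding g_def locally_integrable_def by (auto intro: set_integrable_mult_right)
      show "BMO_norm g = 1"
        unfolding g_def using N N_pos by (subst BMO_norm_cmult) (auto simp: ennreal_mult[symmetric])
    qed
    have "?I f = (\<integral>\<^sup>+x. ennreal N * (ennreal (\<bar>g x - average g Q\<bar> * v x) * indicator Q x) \<partial>lebesgue)"
    proof (intro nn_integral_cong)
      fix x
      have "\<bar>f x - average f Q\<bar> = N * \<bar>g x - average g Q\<bar>"
      proof -
        have "f x - average f Q = N * (g x - average g Q)"
          using N_pos average_cmult[of "1 / N" f Q] by (simp add: g_def field_simps)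
        then show ?thesis using N_pos by (simp add: abs_mult)
      qed
      then show "ennreal (\<bar>f x - average f Q\<bar> * v x) * indicator Q x
        = ennreal N * (ennreal (\<bar>g x - average g Q\<bar> * v x) * indicator Q x)"
        using N_pos v_nonneg by (simp add: ennreal_mult mult_ac)
    qed
    also have "\<dots> = ennreal N * ?I g"
      unfolding g_def by (intro nn_integral_cmult) measurable
    finally have "?I f / ennreal (Y Q) = ennreal N * (?I g / ennreal (Y Q))"
      by (simp add: ennreal_times_divide)
    also have "?I g / ennreal (Y Q) \<le> weighted_BMO_norm v Y g"
      unfolding weighted_BMO_norm_def using Q by (rule SUP_upper)
    also have "\<dots> \<le> ?S"
      using g by (intro SUP_upper) auto
    also have "ennreal N * ?S \<le> ennreal K * ?S"
      using f(2) N by (intro mult_right_mono) auto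
    finally show ?thesis by (simp add: mult_left_mono)
  qed
qed

text \<open>The indicator of a half-space through the centre of the cube has mean \<open>1/2\<close> on it and therefore
  oscillates by exactly \<open>1/2\<close> at each point. Through this test function the mass of a weight on the
  cube is controlled by a weighted oscillation.\<close>

lemma half_cube_oscillation:
  fixes a :: "real ^ 'n"
  assumes l: "0 < l"
  obtains h :: "real ^ 'n \<Rightarrow> real"
  where "locally_integrable h" "BMO_norm h \<le> ennreal 1"
    "\<And>x. \<bar>h x - average h (cube a l)\<bar> = 1 / 2"
proof -
  obtain i :: 'n where True by simp
  define H where "H = {x :: real ^ 'n. x $ i \<le> a $ i + l / 2}"
  define h :: "real ^ 'n \<Rightarrow> real" where "h = indicator H"
  have H [measurable]: "H \<in> sets lebesgue"
    unfolding H_def by (intro sets_completionI_sets[OF] ) (simp add: closed_Collect_le continuous_intros borel_closed)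
  have "h \<in> borel_measurable lebesgue" by (simp add: h_def)
  moreover have "(\<integral>\<^sup>+x\<in>cube b m. ennreal \<bar>h x - 1 / 2\<bar> \<partial>lebesgue) \<le> ennreal (1 / 2) * emeasure lebesgue (cube b m)" for b m
  proof -
    have "(\<integral>\<^sup>+x\<in>cube b m. ennreal \<bar>h x - 1 / 2\<bar> \<partial>lebesgue) = (\<integral>\<^sup>+x. ennreal (1 / 2) * indicator (cube b m) x \<partial>lebesgue)"
      by (intro nn_integral_cong) (auto simp: h_def indicator_def)
    then show ?thesis by (simp add: nn_integral_cmult_indicator)
  qed
  ultimately have h: "locally_integrable h" "BMO_norm h \<le> ennreal (2 * (1 / 2))"
    by (blast intro: BMO_norm_leI)+
  have "cube a l \<inter> H = cbox a (a + (\<chi> j. l * (if j = i then 1 / 2 else 1)))"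
  proof (intro set_eqI iffI)
    fix x assume "x \<in> cbox a (a + (\<chi> j. l * (if j = i then 1 / 2 else 1)))"
    then have "a $ j \<le> x $ j \<and> x $ j \<le> a $ j + l * (if j = i then 1 / 2 else 1)" for j
      by (simp add: mem_box_cart)
    note x = this
    have "x $ j \<le> a $ j + l" for j
      using x[of j] l by (cases "j = i") auto
    with x x[of i] show "x \<in> cube a l \<inter> H"
      by (simp add: H_def mem_cube)
  qed (auto simp: H_def mem_cube mem_box_cart)
  moreover have "measure lborel (cbox a (a + (\<chi> j. l * (if j = i then 1 / 2 else 1)))) = l ^ CARD('n) / 2"
    using l by (subst content_cbox_cart) (auto simp: interval_eq_empty_cart prod.distrib prod.delta not_less)
  ultimately have "measure lebesgue (cube a l \<inter> H) = l ^ CARD('n) / 2" by simp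
  moreover have "measure lebesgue (cube a l) = l ^ CARD('n)"
    using l by (simp add: measure_def emeasure_cube)
  moreover have "(LINT x:cube a l|lebesgue. h x) = measure lebesgue (cube a l \<inter> H)"
    by (simp add: set_lebesgue_integral_def h_def indicator_inter_arith[symmetric])
  ultimately have "average h (cube a l) = 1 / 2"
    using l by (simp add: average_def)
  then have "\<bar>h x - average h (cube a l)\<bar> = 1 / 2" for x
    by (auto simp: h_def indicator_def)
  with h show ?thesis by (intro that) auto
qed

lemma maximal_function_eq_maximal:
  assumes "g \<in> borel_measurable lebesgue"
  shows "maximal_function g x = maximal (density lebesgue (\<lambda>y. ennreal \<bar>g y\<bar>)) x"
  unfolding maximal_function_def maximal_def
  using assms by (intro SUP_cong) (auto simp: emeasure_density elim!: cubesE)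

text \<open>The first summand pays for the multiples of the mass of the cube, through a half-space indicator of norm at most
  1; the second one pays for the level count, whose norm is at most its last factor.\<close>

definition lower_constant :: "'n itself \<Rightarrow> real" where
  "lower_constant _ = (let A = weak_type_constant TYPE('n) in
     2 * (1 + 2 * A ^ 2) + A * (2 * (2 * CARD('n) + 2 * A * 3 ^ CARD('n))))"

text \<open>Two test functions suffice for a given cube \<open>Q\<close>: the level count of the weight restricted to
  \<open>Q\<close>, relative to its average on \<open>Q\<close>, and the indicator of a half-space. The level
  count is integrable with mean at most \<open>2A\<close> on \<open>Q\<close>, where \<open>A\<close> is the weak
  type constant; so replacing it by its deviation from the mean costs a multiple of the mass of \<open>Q\<close>,
  for which the half-space pays.\<close>

lemma maximal_average_le_SUP:
  fixes v :: "real ^ 'n \<Rightarrow> real"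
  assumes v: "weight v" and Q: "Q \<in> cubes" and Y: "0 < Y Q"
  shows "(\<integral>\<^sup>+x\<in>Q. maximal_function (\<lambda>y. v y * indicator Q y) x \<partial>lebesgue) / ennreal (Y Q)
    \<le> ennreal (lower_constant TYPE('n)) *
       (SUP b\<in>{b. locally_integrable b \<and> BMO_norm b = 1}. weighted_BMO_norm v Y b)"
    (is "?M / _ \<le> _ * ?S")
proof -
  let ?A = "weak_type_constant TYPE('n)"
  have A: "0 \<le> ?A" by (simp add: weak_type_constant_def)
  obtain a l where Q': "Q = cube a l" and l: "0 < l" using Q by (auto elim: cubesE)
  have Q_sets [measurable]: "Q \<in> sets lebesgue" by (simp add: Q')
  have v_meas [measurable]: "v \<in> borel_measurable lebesgue" and v_nonneg: "0 \<le> v x" for x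
    using v by (auto simp: weight_def intro: locally_integrable_measurable)
  define \<nu> where "\<nu> = density lebesgue (\<lambda>y. ennreal \<bar>v y * indicator Q y\<bar>)"
  have sets_\<nu>: "sets \<nu> = sets lebesgue" by (simp add: \<nu>_def)
  have M: "maximal_function (\<lambda>y. v y * indicator Q y) = maximal \<nu>"
    unfolding \<nu>_def by (intro ext maximal_function_eq_maximal) measurable
  define W where "W = (\<integral>\<^sup>+x\<in>Q. ennreal (v x) \<partial>lebesgue)"
  have \<nu>_int: "(\<integral>\<^sup>+x. g x \<partial>\<nu>) = (\<integral>\<^sup>+x\<in>Q. ennreal (v x) * g x \<partial>lebesgue)"
    if "g \<in> borel_measurable lebesgue" for g
    unfolding \<nu>_def using that v_nonneg
    by (subst nn_integral_density) (auto intro!: nn_integral_cong simp: indicator_def)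
  have \<nu>_UNIV: "emeasure \<nu> UNIV = W"
    using \<nu>_int[of "\<lambda>_. 1"] sets_eq_imp_space_eq[OF sets_\<nu>] by (simp add: W_def)
  have "set_integrable lebesgue Q v"
    using v Q' by (simp add: weight_def locally_integrable_cubeD)
  then have "(\<integral>\<^sup>+x. ennreal (norm (indicator Q x *\<^sub>R v x)) \<partial>lebesgue) < \<infinity>"
    unfolding set_integrable_def by (simp add: integrable_iff_bounded)
  also have "(\<integral>\<^sup>+x. ennreal (norm (indicator Q x *\<^sub>R v x)) \<partial>lebesgue) = W"
    unfolding W_def using v_nonneg by (intro nn_integral_cong) (auto simp: indicator_def)
  finally have fin: "emeasure \<nu> UNIV < top" by (simp add: \<nu>_UNIV)
  then obtain B where B: "0 \<le> B" "W = ennreal B"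
    unfolding \<nu>_UNIV by (cases W) auto
  show ?thesis
  proof (cases "B = 0")
    case True
    then have "emeasure \<nu> R = 0" for R
      using emeasure_mono[of R UNIV \<nu>] \<nu>_UNIV B sets_\<nu> emeasure_space[of \<nu> R] sets_eq_imp_space_eq[OF sets_\<nu>] by simp
    then have "maximal \<nu> x = 0" for x
      by (auto simp: maximal_def SUP_eq_iff intro!: antisym SUP_least)
    then show ?thesis by (simp add: M)
  next
    case False
    define \<tau> where "\<tau> = B / l ^ CARD('n)"
    have \<tau>: "0 < \<tau>" using B False l by (simp add: \<tau>_def)
    note [measurable] = borel_measurable_level_count[OF sets_\<nu>]
    \<comment> \<open>the count is infinite only on a null set, where the default value \<open>0\<close> does no harm\<close>
    define b where "b x = enn2real (level_count \<nu> \<tau> x)" for x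
    define K where "K = real (2 * CARD('n)) + 2 * ?A * 3 ^ CARD('n)"
    have b_meas [measurable]: "b \<in> borel_measurable lebesgue"
      unfolding b_def by measurable
    have b: "locally_integrable b" "BMO_norm b \<le> ennreal (2 * K)"
      using BMO_norm_leI[OF b_meas level_count_oscillation[OF sets_\<nu> fin \<tau>, folded b_def K_def]] by blast+
    have b_eq: "AE x in lebesgue. level_count \<nu> \<tau> x = ennreal (b x)"
      using AE_level_count_finite[OF sets_\<nu> fin \<tau>]
      by eventually_elim (simp add: b_def less_top)
    have b_nonneg: "0 \<le> b x" for x by (simp add: b_def)
    have "ennreal \<bar>average b Q - 0\<bar> * emeasure lebesgue Q \<le> (\<integral>\<^sup>+x\<in>Q. ennreal \<bar>b x - 0\<bar> \<partial>lebesgue)"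
      unfolding Q' using b(1) l by (intro average_dist_cube_le locally_integrable_cubeD)
    also have "\<dots> \<le> (\<integral>\<^sup>+x. level_count \<nu> \<tau> x \<partial>lebesgue)"
      using b_eq by (intro nn_integral_mono_AE) (auto elim!: eventually_mono simp: indicator_def b_nonneg)
    also have "\<dots> \<le> ennreal (2 * ?A * B / \<tau>)"
      using B \<nu>_UNIV by (intro nn_integral_level_count_le[OF sets_\<nu> fin \<tau>]) auto
    also have "2 * ?A * B / \<tau> = 2 * ?A * l ^ CARD('n)"
      using B False l by (simp add: \<tau>_def)
    finally have "\<bar>average b Q\<bar> * l ^ CARD('n) \<le> 2 * ?A * l ^ CARD('n)"
      using l A by (simp add: Q' emeasure_cube ennreal_mult[symmetric])
    then have avg: "\<bar>average b Q\<bar> \<le> 2 * ?A"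
      using l by simp
    define I where "I f = (\<integral>\<^sup>+x\<in>Q. ennreal (\<bar>f x - average f Q\<bar> * v x) \<partial>lebesgue)" for f
    have level_b: "(\<integral>\<^sup>+x. level_count \<nu> \<tau> x \<partial>\<nu>) \<le> I b + ennreal (2 * ?A) * W"
    proof -
      have "(\<integral>\<^sup>+x. level_count \<nu> \<tau> x \<partial>\<nu>) = (\<integral>\<^sup>+x\<in>Q. ennreal (v x) * level_count \<nu> \<tau> x \<partial>lebesgue)"
        by (rule \<nu>_int) measurable
      also have "\<dots> \<le> (\<integral>\<^sup>+x. ennreal (\<bar>b x - average b Q\<bar> * v x) * indicator Q x
          + ennreal (2 * ?A) * (ennreal (v x) * indicator Q x) \<partial>lebesgue)"
      proof (intro nn_integral_mono_AE)
        show "AE x in lebesgue. ennreal (v x) * level_count \<nu> \<tau> x * indicator Q x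
            \<le> ennreal (\<bar>b x - average b Q\<bar> * v x) * indicator Q x + ennreal (2 * ?A) * (ennreal (v x) * indicator Q x)"
          using b_eq
        proof eventually_elim
          case (elim x)
          have "b x \<le> \<bar>b x - average b Q\<bar> + 2 * ?A" using avg by linarith
          from mult_right_mono[OF this v_nonneg[of x]]
          have "v x * b x \<le> \<bar>b x - average b Q\<bar> * v x + 2 * ?A * v x" by (simp add: algebra_simps)
          then have "ennreal (v x * b x) \<le> ennreal (\<bar>b x - average b Q\<bar> * v x) + ennreal (2 * ?A * v x)"
            using v_nonneg A by (simp add: ennreal_leI flip: ennreal_plus)
          then show ?case
            using v_nonneg A b_nonneg elim by (simp add: ennreal_mult indicator_def)
        qed
      qed
      also have "\<dots> = I b + ennreal (2 * ?A) * W"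
        unfolding I_def W_def by (simp add: nn_integral_add nn_integral_cmult)
      finally show ?thesis .
    qed
    obtain h :: "real ^ 'n \<Rightarrow> real" where h: "locally_integrable h" "BMO_norm h \<le> ennreal 1"
      "\<And>x. \<bar>h x - average h Q\<bar> = 1 / 2"
      unfolding Q' using half_cube_oscillation[OF l] by metis
    have "I h = (\<integral>\<^sup>+x. ennreal (1 / 2) * (ennreal (v x) * indicator Q x) \<partial>lebesgue)"
      unfolding I_def h(3) by (intro nn_integral_cong) (simp only: ennreal_mult'[of "1 / 2"] mult.assoc zero_le_divide_1_iff zero_le_numeral)
    also have "\<dots> = ennreal (1 / 2) * W"
      unfolding W_def by (intro nn_integral_cmult) measurable
    finally have "ennreal 2 * I h = (ennreal 2 * ennreal (1 / 2)) * W"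
      by (simp only: mult.assoc)
    also have "ennreal 2 * ennreal (1 / 2) = 1"
      by (subst ennreal_mult[symmetric]) auto
    finally have W: "W = ennreal 2 * I h" by simp
    have "?M = (\<integral>\<^sup>+x\<in>Q. maximal \<nu> x \<partial>lebesgue)" by (simp add: M)
    also have "\<dots> \<le> ennreal \<tau> * emeasure lebesgue Q + ennreal ?A * (\<integral>\<^sup>+x. level_count \<nu> \<tau> x \<partial>\<nu>)"
      by (rule nn_integral_maximal_le_level_count[OF sets_\<nu> fin \<tau> Q_sets])
    also have "ennreal \<tau> * emeasure lebesgue Q = W"
      using l B by (simp add: Q' emeasure_cube \<tau>_def ennreal_mult[symmetric])
    also have "W + ennreal ?A * (\<integral>\<^sup>+x. level_count \<nu> \<tau> x \<partial>\<nu>) \<le> W + ennreal ?A * (I b + ennreal (2 * ?A) * W)"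
      by (intro add_left_mono mult_left_mono level_b) simp
    also have "\<dots> = ennreal (1 + 2 * ?A ^ 2) * W + ennreal ?A * I b"
      using A B by (simp add: ennreal_mult[symmetric] distrib_left distrib_right mult_ac power2_eq_square add_ac
          flip: ennreal_plus)
    also have "\<dots> = ennreal (2 * (1 + 2 * ?A ^ 2)) * I h + ennreal ?A * I b"
      unfolding W using A by (simp add: ennreal_mult mult_ac)
    finally have "?M / ennreal (Y Q) \<le> ennreal (2 * (1 + 2 * ?A ^ 2)) * (I h / ennreal (Y Q)) + ennreal ?A * (I b / ennreal (Y Q))"
      by (auto simp: ennreal_times_divide add_divide_distrib_ennreal[symmetric] intro: divide_right_mono_ennreal)
    also have "\<dots> \<le> ennreal (2 * (1 + 2 * ?A ^ 2)) * (ennreal 1 * ?S) + ennreal ?A * (ennreal (2 * K) * ?S)"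
      unfolding I_def using h b Y Q v by (intro add_mono mult_left_mono weighted_oscillation_le_SUP) auto
    also have "\<dots> = ennreal (lower_constant TYPE('n)) * ?S"
    proof -
      have "ennreal (lower_constant TYPE('n)) = ennreal (2 * (1 + 2 * ?A ^ 2)) * ennreal 1 + ennreal ?A * ennreal (2 * K)"
        using A by (simp add: lower_constant_def Let_def K_def ennreal_mult[symmetric] flip: ennreal_plus)
      then show ?thesis by (simp only: distrib_right mult.assoc)
    qed
    finally show ?thesis .
  qed
qed

section \<open>Dyadic cubes\<close>

text \<open>The corner of the cell that contains \<open>x\<close> in the grid of mesh \<open>l / 2\<^sup>k\<close> with
  origin \<open>a\<close>. Describing cells by the floors of scaled coordinates reduces nesting and disjointness
  to integer division.\<close>

definition dyadic_corner :: "real ^ 'n \<Rightarrow> real \<Rightarrow> nat \<Rightarrow> real ^ 'n \<Rightarrow> real ^ 'n" where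
  "dyadic_corner a l k x = (\<chi> i. a $ i + l / 2 ^ k * of_int \<lfloor>(x $ i - a $ i) * 2 ^ k / l\<rfloor>)"

abbreviation dyadic_cube :: "real ^ 'n \<Rightarrow> real \<Rightarrow> nat \<Rightarrow> real ^ 'n \<Rightarrow> (real ^ 'n) set" where
  "dyadic_cube a l k x \<equiv> half_open_cube (dyadic_corner a l k x) (l / 2 ^ k)"

text \<open>Cubes are recorded as pairs of corner and side length because an estimate on a half-open cube has to refer to
  the closed cube with the same data.\<close>

definition disjoint_subcubes :: "real ^ 'n \<Rightarrow> real \<Rightarrow> ((real ^ 'n) \<times> real) set \<Rightarrow> bool" where
  "disjoint_subcubes a l \<F> \<longleftrightarrow> countable \<F> \<and> disjoint_family_on (\<lambda>(c, s). half_open_cube c s) \<F> \<and>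
     (\<forall>(c, s)\<in>\<F>. 0 < s \<and> half_open_cube c s \<subseteq> half_open_cube a l)"

abbreviation union_cubes :: "((real ^ 'n) \<times> real) set \<Rightarrow> (real ^ 'n) set" where
  "union_cubes \<F> \<equiv> (\<Union>(c, s)\<in>\<F>. half_open_cube c s)"

lemma disjoint_subcubesD:
  assumes "disjoint_subcubes a l \<F>" "(c, s) \<in> \<F>"
  shows "0 < s" "half_open_cube c s \<subseteq> half_open_cube a l"
  using assms by (auto simp: disjoint_subcubes_def)

lemma sets_union_cubes: "disjoint_subcubes a l \<F> \<Longrightarrow> union_cubes \<F> \<in> sets lebesgue"
  unfolding disjoint_subcubes_def by (intro sets.countable_UN') auto

lemma nn_integral_union_cubes:
  assumes [measurable]: "g \<in> borel_measurable lebesgue" and \<F>: "disjoint_subcubes a l \<F>"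
  shows "(\<integral>\<^sup>+x\<in>union_cubes \<F>. g x \<partial>lebesgue)
    = (\<integral>\<^sup>+p. (\<integral>\<^sup>+x\<in>half_open_cube (fst p) (snd p). g x \<partial>lebesgue) \<partial>count_space \<F>)"
proof -
  have "(\<integral>\<^sup>+x\<in>union_cubes \<F>. g x \<partial>lebesgue) = emeasure (density lebesgue g) (union_cubes \<F>)"
    using sets_union_cubes[OF \<F>] by (simp add: emeasure_density)
  also have "\<dots> = (\<integral>\<^sup>+p. emeasure (density lebesgue g) (case p of (c, s) \<Rightarrow> half_open_cube c s) \<partial>count_space \<F>)"
    using \<F> unfolding disjoint_subcubes_def by (intro emeasure_UN_countable) auto
  also have "\<dots> = (\<integral>\<^sup>+p. (\<integral>\<^sup>+x\<in>half_open_cube (fst p) (snd p). g x \<partial>lebesgue) \<partial>count_space \<F>)"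
    by (intro nn_integral_cong) (auto simp: emeasure_density)
  finally show ?thesis .
qed

context
  fixes a :: "real ^ 'n" and l :: real
  assumes l: "0 < l"
begin

lemma mem_dyadic_cube_iff:
  "y \<in> dyadic_cube a l k x \<longleftrightarrow> (\<forall>i. \<lfloor>(y $ i - a $ i) * 2 ^ k / l\<rfloor> = \<lfloor>(x $ i - a $ i) * 2 ^ k / l\<rfloor>)"
proof -
  have "a $ i + l / 2 ^ k * of_int z \<le> y $ i \<and> y $ i < a $ i + l / 2 ^ k * of_int z + l / 2 ^ k
    \<longleftrightarrow> \<lfloor>(y $ i - a $ i) * 2 ^ k / l\<rfloor> = z" for i z
    using l by (simp add: floor_eq_iff field_simps)
  then show ?thesis
    by (simp add: half_open_cube_def dyadic_corner_def)
qed

lemma dyadic_cube_self: "x \<in> dyadic_cube a l k x"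
  by (simp add: mem_dyadic_cube_iff)

text \<open>The floors at scale \<open>k\<close> determine those at each coarser scale, by integer division.\<close>

lemma dyadic_corner_cong:
  assumes y: "y \<in> dyadic_cube a l k x" and "j \<le> k"
  shows "dyadic_corner a l j y = dyadic_corner a l j x"
proof -
  have *: "\<lfloor>(z $ i - a $ i) * 2 ^ j / l\<rfloor> = \<lfloor>(z $ i - a $ i) * 2 ^ k / l\<rfloor> div 2 ^ (k - j)" for z :: "real ^ 'n" and i
  proof -
    have "(2 :: real) ^ k = 2 ^ j * 2 ^ (k - j)"
      using \<open>j \<le> k\<close> by (simp add: power_add[symmetric])
    then have "(z $ i - a $ i) * 2 ^ j / l = ((z $ i - a $ i) * 2 ^ k / l) / of_int (2 ^ (k - j))"
      by simp
    then show ?thesis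
      by (simp only: floor_divide_real_eq_div zero_le_power zero_le_numeral)
  qed
  show ?thesis
    using y[unfolded mem_dyadic_cube_iff] unfolding dyadic_corner_def * by simp
qed

lemma dyadic_cube_mono: "j \<le> k \<Longrightarrow> dyadic_cube a l k x \<subseteq> dyadic_cube a l j x"
proof
  fix y assume "j \<le> k" "y \<in> dyadic_cube a l k x"
  then show "y \<in> dyadic_cube a l j x"
    using dyadic_cube_self[of y j] by (simp add: dyadic_corner_cong)
qed

lemma dyadic_corner_0: "x \<in> half_open_cube a l \<Longrightarrow> dyadic_corner a l 0 x = a"
proof -
  assume "x \<in> half_open_cube a l"
  then have "\<lfloor>(x $ i - a $ i) / l\<rfloor> = 0" for i
    using l by (simp add: half_open_cube_def floor_eq_iff field_simps)
  then show ?thesis by (simp add: dyadic_corner_def vec_eq_iff)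
qed

lemma countable_dyadic: "countable {(dyadic_corner a l k x, l / 2 ^ k) | k x. True}"
proof (rule countable_subset)
  show "{(dyadic_corner a l k x, l / 2 ^ k) | k x. True}
    \<subseteq> (\<Union>k. range (\<lambda>z :: 'n \<Rightarrow> int. ((\<chi> i. a $ i + l / 2 ^ k * of_int (z i)), l / 2 ^ k)))"
    by (fastforce simp: dyadic_corner_def)
qed auto

text \<open>Each point runs through the dyadic cubes around it from the largest on and stops at the first one with property
  \<open>P\<close>. All points of that cube have the same history and stop at the same cube, so the stopping cubes
  are pairwise disjoint; and a stopping cube other than the largest one has a parent that fails \<open>P\<close>.\<close>

lemma dyadic_stopping:
  fixes P :: "real ^ 'n \<Rightarrow> real \<Rightarrow> bool"
  obtains \<F> where "disjoint_subcubes a l \<F>"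
    "\<forall>(c, s)\<in>\<F>. P c s \<and> (\<exists>k x. c = dyadic_corner a l k x \<and> s = l / 2 ^ k)"
    "\<forall>(c, s)\<in>\<F>. \<not> P a l \<longrightarrow> (\<exists>c'. half_open_cube c s \<subseteq> half_open_cube c' (2 * s) \<and> \<not> P c' (2 * s))"
    "\<forall>x\<in>half_open_cube a l - union_cubes \<F>. \<forall>k. \<not> P (dyadic_corner a l k x) (l / 2 ^ k)"
proof -
  define Pr where "Pr x k \<longleftrightarrow> P (dyadic_corner a l k x) (l / 2 ^ k)" for x k
  define \<kappa> where "\<kappa> x = (LEAST k. Pr x k)" for x
  define B where "B = {x \<in> half_open_cube a l. \<exists>k. Pr x k}"
  define \<phi> where "\<phi> x = (dyadic_corner a l (\<kappa> x) x, l / 2 ^ \<kappa> x)" for x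
  have Pr_\<kappa>: "Pr x (\<kappa> x)" if "x \<in> B" for x
    using that unfolding B_def \<kappa>_def by (auto intro: LeastI)
  have below: "\<not> Pr x k" if "k < \<kappa> x" for x k
    using that unfolding \<kappa>_def by (rule not_less_Least)
  have same: "\<phi> z = \<phi> x" if x: "x \<in> B" and z: "z \<in> dyadic_cube a l (\<kappa> x) x" for x z
  proof -
    have eq: "dyadic_corner a l k z = dyadic_corner a l k x" if "k \<le> \<kappa> x" for k
      using dyadic_corner_cong[OF z that] .
    have "\<kappa> z = \<kappa> x"
      unfolding \<kappa>_def[of z]
    proof (rule Least_equality)
      show "Pr z (\<kappa> x)" using Pr_\<kappa>[OF x] by (simp add: Pr_def eq)
    next
      fix k assume "Pr z k"
      show "\<kappa> x \<le> k"
      proof (rule ccontr)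
        assume "\<not> \<kappa> x \<le> k"
        then have "k < \<kappa> x" by simp
        with below[OF this] \<open>Pr z k\<close> show False by (simp add: Pr_def eq)
      qed
    qed
    then show ?thesis by (simp add: \<phi>_def eq)
  qed
  have self: "x \<in> (\<lambda>(c, s). half_open_cube c s) (\<phi> x)" for x
    using dyadic_cube_self by (simp add: \<phi>_def)
  have sub: "dyadic_cube a l k x \<subseteq> half_open_cube a l" if "x \<in> B" for x k
    using dyadic_cube_mono[of 0 k x] dyadic_corner_0[of x] that by (simp add: B_def)
  show ?thesis
  proof (rule that[of "\<phi> ` B"])
    have "countable (\<phi> ` B)"
      by (rule countable_subset[OF _ countable_dyadic]) (auto simp: \<phi>_def)
    moreover have "disjoint_family_on (\<lambda>(c, s). half_open_cube c s) (\<phi> ` B)"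
      unfolding disjoint_family_on_def
    proof (intro ballI impI)
      fix p q assume "p \<in> \<phi> ` B" "q \<in> \<phi> ` B" and neq: "p \<noteq> q"
      then obtain x y where xy: "x \<in> B" "p = \<phi> x" "y \<in> B" "q = \<phi> y" by blast
      show "(\<lambda>(c, s). half_open_cube c s) p \<inter> (\<lambda>(c, s). half_open_cube c s) q = {}"
      proof (rule ccontr)
        assume "\<not> ?thesis"
        then obtain z where "z \<in> dyadic_cube a l (\<kappa> x) x" "z \<in> dyadic_cube a l (\<kappa> y) y"
          by (auto simp: xy \<phi>_def)
        then have "\<phi> x = \<phi> y"
          using same[OF xy(1)] same[OF xy(3)] by metis
        with neq xy show False by simp
      qed
    qed
    ultimately show "disjoint_subcubes a l (\<phi> ` B)"
      using l sub by (auto simp: disjoint_subcubes_def \<phi>_def)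
    show "\<forall>(c, s)\<in>\<phi> ` B. P c s \<and> (\<exists>k x. c = dyadic_corner a l k x \<and> s = l / 2 ^ k)"
      using Pr_\<kappa> by (auto simp: \<phi>_def Pr_def)
    show "\<forall>(c, s)\<in>\<phi> ` B. \<not> P a l \<longrightarrow> (\<exists>c'. half_open_cube c s \<subseteq> half_open_cube c' (2 * s) \<and> \<not> P c' (2 * s))"
    proof (clarify, unfold \<phi>_def prod.inject, clarify)
      fix x assume x: "x \<in> B" and "\<not> P a l"
      have "\<kappa> x \<noteq> 0"
      proof
        assume "\<kappa> x = 0"
        with Pr_\<kappa>[OF x] dyadic_corner_0[of x] x \<open>\<not> P a l\<close> show False
          by (simp add: Pr_def B_def)
      qed
      then obtain m where m: "\<kappa> x = Suc m" by (cases "\<kappa> x") auto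
      then have "2 * (l / 2 ^ \<kappa> x) = l / 2 ^ m" by simp
      moreover have "dyadic_cube a l (\<kappa> x) x \<subseteq> dyadic_cube a l m x"
        by (rule dyadic_cube_mono) (simp add: m)
      moreover have "\<not> P (dyadic_corner a l m x) (l / 2 ^ m)"
        using below[of m x] by (simp add: m Pr_def)
      ultimately show "\<exists>c'. dyadic_cube a l (\<kappa> x) x \<subseteq> half_open_cube c' (2 * (l / 2 ^ \<kappa> x)) \<and> \<not> P c' (2 * (l / 2 ^ \<kappa> x))"
        by metis
    qed
    show "\<forall>x\<in>half_open_cube a l - union_cubes (\<phi> ` B). \<forall>k. \<not> P (dyadic_corner a l k x) (l / 2 ^ k)"
    proof (intro ballI allI)
      fix x k assume x: "x \<in> half_open_cube a l - union_cubes (\<phi> ` B)"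
      have "x \<notin> B" using x self[of x] by (auto simp: \<phi>_def)
      with x show "\<not> P (dyadic_corner a l k x) (l / 2 ^ k)" by (auto simp: B_def Pr_def)
    qed
  qed
qed

lemma dyadic_cube_subset_open:
  assumes "open U" "x \<in> U"
  obtains k where "dyadic_cube a l k x \<subseteq> U"
proof -
  obtain e where e: "0 < e" "ball x e \<subseteq> U"
    using assms by (meson openE)
  obtain k where "2 * real CARD('n) * l / e < 2 ^ k"
    using real_arch_pow[of 2] by auto
  then have k: "2 * (real CARD('n) * (l / 2 ^ k)) < e"
    using e(1) by (simp add: field_simps)
  have "dyadic_cube a l k x \<subseteq> ball x e"
  proof
    fix y assume "y \<in> dyadic_cube a l k x"
    then have "dist (dyadic_corner a l k x) y \<le> real CARD('n) * (l / 2 ^ k)"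
      "dist (dyadic_corner a l k x) x \<le> real CARD('n) * (l / 2 ^ k)"
      using cube_subset_cball half_open_cube_subset_cube dyadic_cube_self by (fastforce simp: subset_iff)+
    then have "dist x y \<le> 2 * (real CARD('n) * (l / 2 ^ k))"
      using dist_triangle3[of x y "dyadic_corner a l k x"] by (simp only: dist_commute) (smt (verit, best))
    with k show "y \<in> ball x e" by simp
  qed
  with e show ?thesis by (intro that) auto
qed

text \<open>The dyadic form of the Lebesgue differentiation theorem that is needed here. Any measurable subset
  \<open>E\<close> of \<open>G\<close> is covered, inside an open set \<open>U\<close> around it, by disjoint
  dyadic cubes that meet \<open>E\<close> and hence have average at most \<open>\<theta>\<close>. So the integral
  of \<open>f\<close> over \<open>E\<close> is at most \<open>\<theta>\<close> times the measure of
  \<open>U\<close>, and by outer regularity at most \<open>\<theta>\<close> times that of \<open>E\<close>. For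
  the part of \<open>G\<close> where \<open>f\<close> exceeds \<open>\<theta>\<close> this forces measure zero.\<close>

lemma AE_le_of_dyadic_averages_le:
  fixes f :: "real ^ 'n \<Rightarrow> ennreal"
  assumes f [measurable]: "f \<in> borel_measurable lebesgue" and \<theta>: "0 \<le> \<theta>"
    and G [measurable]: "G \<in> sets lebesgue" and G_sub: "G \<subseteq> half_open_cube a l"
    and avg: "\<And>x k. x \<in> G \<Longrightarrow> (\<integral>\<^sup>+y\<in>dyadic_cube a l k x. f y \<partial>lebesgue)
      \<le> ennreal \<theta> * emeasure lebesgue (dyadic_cube a l k x)"
  shows "AE x in lebesgue. x \<in> G \<longrightarrow> f x \<le> ennreal \<theta>"
proof -
  define E where "E = {x \<in> G. ennreal \<theta> < f x}"
  have E [measurable]: "E \<in> sets lebesgue" 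
  proof -
    have "E = G \<inter> {x \<in> space lebesgue. ennreal \<theta> < f x}" by (auto simp: E_def)
    also have "\<dots> \<in> sets lebesgue" by measurable
    finally show ?thesis .
  qed
  have E_fin: "emeasure lebesgue E < top"
  proof -
    have "emeasure lebesgue E \<le> emeasure lebesgue (half_open_cube a l)"
      using G_sub by (intro emeasure_mono) (auto simp: E_def)
    also have "\<dots> < top" using l by (simp add: emeasure_half_open_cube)
    finally show ?thesis .
  qed
  have open_bound: "(\<integral>\<^sup>+x\<in>E. f x \<partial>lebesgue) \<le> ennreal \<theta> * emeasure lebesgue U" if U: "open U" "E \<subseteq> U" for U
  proof -
    define P where "P c s \<longleftrightarrow> half_open_cube c s \<subseteq> U \<and> half_open_cube c s \<inter> E \<noteq> {}" for c s
    obtain \<F> where \<F>: "disjoint_subcubes a l \<F>"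
      "\<forall>(c, s)\<in>\<F>. P c s \<and> (\<exists>k x. c = dyadic_corner a l k x \<and> s = l / 2 ^ k)"
      "\<forall>x\<in>half_open_cube a l - union_cubes \<F>. \<forall>k. \<not> P (dyadic_corner a l k x) (l / 2 ^ k)"
      by (rule dyadic_stopping[of P])
    let ?U = "union_cubes \<F>"
    note U_sets [measurable] = sets_union_cubes[OF \<F>(1)]
    have "E \<subseteq> ?U"
    proof
      fix x assume x: "x \<in> E"
      with U(2) have "x \<in> U" by blast
      then obtain k where "dyadic_cube a l k x \<subseteq> U" by (rule dyadic_cube_subset_open[OF U(1)])
      then have "P (dyadic_corner a l k x) (l / 2 ^ k)"
        using x dyadic_cube_self[of x k] by (auto simp: P_def)
      moreover have "x \<in> half_open_cube a l" using x G_sub by (auto simp: E_def)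
      ultimately show "x \<in> ?U" using \<F>(3) by (metis DiffI)
    qed
    then have "(\<integral>\<^sup>+x\<in>E. f x \<partial>lebesgue) \<le> (\<integral>\<^sup>+x\<in>?U. f x \<partial>lebesgue)"
      by (intro nn_integral_mono) (auto simp: indicator_def)
    also have "\<dots> = (\<integral>\<^sup>+p. (\<integral>\<^sup>+x\<in>half_open_cube (fst p) (snd p). f x \<partial>lebesgue) \<partial>count_space \<F>)"
      by (rule nn_integral_union_cubes[OF f \<F>(1)])
    also have "\<dots> \<le> (\<integral>\<^sup>+p. (\<integral>\<^sup>+x\<in>half_open_cube (fst p) (snd p). ennreal \<theta> \<partial>lebesgue) \<partial>count_space \<F>)"
    proof (rule nn_integral_mono)
      fix p assume "p \<in> space (count_space \<F>)"
      then obtain c s where p: "p = (c, s)" "(c, s) \<in> \<F>" by (cases p) auto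
      obtain k x where kx: "c = dyadic_corner a l k x" "s = l / 2 ^ k" and "P c s"
        using bspec[OF \<F>(2) p(2)] by auto
      obtain y where y: "y \<in> dyadic_cube a l k x" "y \<in> E" using \<open>P c s\<close> kx by (auto simp: P_def)
      have "dyadic_corner a l k y = c" using dyadic_corner_cong[OF y(1), of k] kx by simp
      with avg[of y k] y(2) kx p show "(\<integral>\<^sup>+x\<in>half_open_cube (fst p) (snd p). f x \<partial>lebesgue)
        \<le> (\<integral>\<^sup>+x\<in>half_open_cube (fst p) (snd p). ennreal \<theta> \<partial>lebesgue)"
        by (simp add: E_def nn_integral_cmult_indicator)
    qed
    also have "\<dots> = (\<integral>\<^sup>+x\<in>?U. ennreal \<theta> \<partial>lebesgue)"
      by (rule nn_integral_union_cubes[OF _ \<F>(1), symmetric]) simp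
    also have "\<dots> = ennreal \<theta> * emeasure lebesgue ?U"
      by (simp add: nn_integral_cmult_indicator)
    also have "\<dots> \<le> ennreal \<theta> * emeasure lebesgue U"
      using \<F>(2) U(1) by (intro mult_left_mono emeasure_mono) (auto simp: P_def intro: borel_open)
    finally show ?thesis .
  qed
  have E_bound: "(\<integral>\<^sup>+x\<in>E. f x \<partial>lebesgue) \<le> ennreal \<theta> * emeasure lebesgue E"
  proof (rule ennreal_le_epsilon)
    fix e :: real assume e: "0 < e"
    define d where "d = e / (\<theta> + 1)"
    have d: "0 < d" "\<theta> * d \<le> e" using e \<theta> by (auto simp: d_def field_simps)
    obtain U where U: "open U" "E \<subseteq> U" "U - E \<in> lmeasurable" "emeasure lebesgue (U - E) < ennreal d"
      using sets_lebesgue_outer_open[OF E d(1)] by blast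
    have "(\<integral>\<^sup>+x\<in>E. f x \<partial>lebesgue) \<le> ennreal \<theta> * emeasure lebesgue U"
      by (rule open_bound[OF U(1,2)])
    also have "emeasure lebesgue U = emeasure lebesgue E + emeasure lebesgue (U - E)"
      using U by (subst plus_emeasure) (auto simp: Un_absorb1)
    also have "ennreal \<theta> * (emeasure lebesgue E + emeasure lebesgue (U - E)) \<le> ennreal \<theta> * (emeasure lebesgue E + ennreal d)"
      using U by (intro mult_left_mono add_left_mono) auto
    also have "\<dots> \<le> ennreal \<theta> * emeasure lebesgue E + ennreal e"
      using d \<theta> by (auto simp: distrib_left ennreal_mult[symmetric] intro!: add_left_mono ennreal_leI)
    finally show "(\<integral>\<^sup>+x\<in>E. f x \<partial>lebesgue) \<le> ennreal \<theta> * emeasure lebesgue E + ennreal e" .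
  qed
  have "AE x in lebesgue. f x * indicator E x \<le> ennreal \<theta> * indicator E x"
  proof (rule ccontr)
    assume "\<not> ?thesis"
    moreover have int: "(\<integral>\<^sup>+x. ennreal \<theta> * indicator E x \<partial>lebesgue) = ennreal \<theta> * emeasure lebesgue E"
      by (simp add: nn_integral_cmult_indicator)
    moreover have "ennreal \<theta> * emeasure lebesgue E \<noteq> \<infinity>"
      using E_fin by (auto simp: ennreal_mult_eq_top_iff)
    moreover have "AE x in lebesgue. ennreal \<theta> * indicator E x \<le> f x * indicator E x"
      by (intro AE_I2) (auto simp: E_def indicator_def)
    ultimately have "(\<integral>\<^sup>+x. ennreal \<theta> * indicator E x \<partial>lebesgue) < (\<integral>\<^sup>+x. f x * indicator E x \<partial>lebesgue)"
      by (intro nn_integral_less) (auto simp del: nn_integral_indicator)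
    with E_bound show False by (simp add: nn_integral_cmult_indicator)
  qed
  then show ?thesis
  proof eventually_elim
    case (elim x)
    then show ?case by (cases "x \<in> E") (auto simp: E_def)
  qed
qed

text \<open>The stopping cubes for the property that the average exceeds \<open>\<theta>\<close>. The average over a parent
  does not exceed \<open>\<theta>\<close>, so the average over the cube itself is at most
  \<open>2\<^sup>n\<theta>\<close>.\<close>

lemma calderon_zygmund:
  fixes f :: "real ^ 'n \<Rightarrow> ennreal"
  assumes f [measurable]: "f \<in> borel_measurable lebesgue" and \<theta>: "0 \<le> \<theta>"
    and avg: "(\<integral>\<^sup>+x\<in>half_open_cube a l. f x \<partial>lebesgue) \<le> ennreal \<theta> * emeasure lebesgue (half_open_cube a l)"
  obtains \<F> where "disjoint_subcubes a l \<F>"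
    "\<forall>(c, s)\<in>\<F>. ennreal \<theta> * emeasure lebesgue (half_open_cube c s) \<le> (\<integral>\<^sup>+x\<in>half_open_cube c s. f x \<partial>lebesgue)"
    "\<forall>(c, s)\<in>\<F>. (\<integral>\<^sup>+x\<in>half_open_cube c s. f x \<partial>lebesgue) \<le> ennreal (2 ^ CARD('n) * \<theta>) * emeasure lebesgue (half_open_cube c s)"
    "AE x in lebesgue. x \<in> half_open_cube a l - union_cubes \<F> \<longrightarrow> f x \<le> ennreal \<theta>"
proof -
  define P where "P c s \<longleftrightarrow>
    ennreal \<theta> * emeasure lebesgue (half_open_cube c s) < (\<integral>\<^sup>+x\<in>half_open_cube c s. f x \<partial>lebesgue)" for c s
  have not_top: "\<not> P a l" using avg by (simp add: P_def)
  obtain \<F> where \<F>: "disjoint_subcubes a l \<F>"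
    "\<forall>(c, s)\<in>\<F>. P c s \<and> (\<exists>k x. c = dyadic_corner a l k x \<and> s = l / 2 ^ k)"
    "\<forall>(c, s)\<in>\<F>. \<not> P a l \<longrightarrow> (\<exists>c'. half_open_cube c s \<subseteq> half_open_cube c' (2 * s) \<and> \<not> P c' (2 * s))"
    "\<forall>x\<in>half_open_cube a l - union_cubes \<F>. \<forall>k. \<not> P (dyadic_corner a l k x) (l / 2 ^ k)"
    by (rule dyadic_stopping[of P])
  note [measurable] = sets_union_cubes[OF \<F>(1)]
  show ?thesis
  proof (rule that[OF \<F>(1)]; (intro ballI; clarify)?)
    fix c s assume cs: "(c, s) \<in> \<F>"
    show "ennreal \<theta> * emeasure lebesgue (half_open_cube c s) \<le> (\<integral>\<^sup>+x\<in>half_open_cube c s. f x \<partial>lebesgue)"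
      using bspec[OF \<F>(2) cs] by (auto simp: P_def)
    have s: "0 < s" using disjoint_subcubesD[OF \<F>(1) cs] by simp
    obtain c' where c': "half_open_cube c s \<subseteq> half_open_cube c' (2 * s)" "\<not> P c' (2 * s)"
      using bspec[OF \<F>(3) cs] not_top by auto
    have "(\<integral>\<^sup>+x\<in>half_open_cube c s. f x \<partial>lebesgue) \<le> (\<integral>\<^sup>+x\<in>half_open_cube c' (2 * s). f x \<partial>lebesgue)"
      using c'(1) by (intro nn_integral_mono) (auto simp: indicator_def)
    also have "\<dots> \<le> ennreal \<theta> * emeasure lebesgue (half_open_cube c' (2 * s))"
      using c'(2) by (simp add: P_def)
    also have "\<dots> = ennreal (2 ^ CARD('n) * \<theta>) * emeasure lebesgue (half_open_cube c s)"
      using s \<theta> by (simp add: emeasure_half_open_cube power_mult_distrib ennreal_mult[symmetric] mult_ac)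
    finally show "(\<integral>\<^sup>+x\<in>half_open_cube c s. f x \<partial>lebesgue) \<le> ennreal (2 ^ CARD('n) * \<theta>) * emeasure lebesgue (half_open_cube c s)" .
  next
    have "AE x in lebesgue. x \<in> half_open_cube a l - union_cubes \<F> \<longrightarrow> f x \<le> ennreal \<theta>"
      using \<F>(4) by (intro AE_le_of_dyadic_averages_le \<theta>) (auto simp: not_less P_def)
    then show "AE x in lebesgue. x \<in> half_open_cube a l - union_cubes \<F> \<longrightarrow> f x \<le> ennreal \<theta>" .
  qed
qed

end

section \<open>The upper bound\<close>

lemma maximal_mono:
  assumes "\<And>R. R \<in> cubes \<Longrightarrow> emeasure \<mu> R \<le> emeasure \<nu> R"
  shows "maximal \<mu> x \<le> maximal \<nu> x"
  unfolding maximal_def using assms by (intro SUP_mono) (auto intro: divide_right_mono_ennreal)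

text \<open>The restriction is to the half-open cube so that it is monotone along dyadic subcubes.\<close>

definition restricted_weight :: "(real ^ 'n \<Rightarrow> ennreal) \<Rightarrow> real ^ 'n \<Rightarrow> real \<Rightarrow> (real ^ 'n) measure" where
  "restricted_weight w a l = density lebesgue (\<lambda>x. w x * indicator (half_open_cube a l) x)"

lemma sets_restricted_weight [simp]: "sets (restricted_weight w a l) = sets lebesgue"
  by (simp add: restricted_weight_def)

lemma emeasure_restricted_weight:
  assumes "w \<in> borel_measurable lebesgue" "X \<in> sets lebesgue"
  shows "emeasure (restricted_weight w a l) X = (\<integral>\<^sup>+x\<in>X. w x * indicator (half_open_cube a l) x \<partial>lebesgue)"
  unfolding restricted_weight_def using assms by (intro emeasure_density) auto

text \<open>An error term \<open>e\<close> per unit of volume on all cubes improves to \<open>e/2\<close>. The cubes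
  selected from \<open>a, l\<close> at height 2 fill at most half of it, because the mean oscillation is at most
  1. On the good part \<open>G\<close> the deviation is at most 2, and on a selected cube the two averages of
  \<open>b\<close> differ by at most \<open>2\<^sup>n\<^sup>+\<^sup>1\<close>; both contribute at most
  \<open>2\<^sup>n\<^sup>+\<^sup>1\<close> times the mass of the weight. As \<open>G\<close> has at least half of
  the volume and the maximal function is at least the average of the weight there, this mass is at most twice the
  integral of the maximal function over \<open>G\<close>. What remains are the oscillations on the selected cubes,
  to which the assumed bound applies; its error term is then summed over half of the volume only.\<close>

lemma oscillation_step:
  fixes b :: "real ^ 'n \<Rightarrow> real" and w :: "real ^ 'n \<Rightarrow> ennreal"
  assumes b: "locally_integrable b" "BMO_norm b \<le> 1"
    and w [measurable]: "w \<in> borel_measurable lebesgue"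
    and K: "K = 2 ^ (CARD('n) + 2)"
    and bound: "\<And>c s. 0 < s \<Longrightarrow>
      (\<integral>\<^sup>+x\<in>half_open_cube c s. ennreal \<bar>b x - average b (cube c s)\<bar> * w x \<partial>lebesgue)
      \<le> ennreal K * (\<integral>\<^sup>+x\<in>half_open_cube c s. maximal (restricted_weight w c s) x \<partial>lebesgue)
        + e * emeasure lebesgue (half_open_cube c s)"
    and l: "0 < l"
  shows "(\<integral>\<^sup>+x\<in>half_open_cube a l. ennreal \<bar>b x - average b (cube a l)\<bar> * w x \<partial>lebesgue)
      \<le> ennreal K * (\<integral>\<^sup>+x\<in>half_open_cube a l. maximal (restricted_weight w a l) x \<partial>lebesgue)
        + (e * ennreal (1 / 2)) * emeasure lebesgue (half_open_cube a l)"
proof -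
  define n where "n = CARD('n)"
  note [measurable] = locally_integrable_measurable[OF b(1)]
  let ?R = "half_open_cube a l"
  define f where "f x = ennreal \<bar>b x - average b (cube a l)\<bar>" for x
  have f [measurable]: "f \<in> borel_measurable lebesgue"
    unfolding f_def by measurable
  have f_int: "(\<integral>\<^sup>+x\<in>?R. f x \<partial>lebesgue) \<le> emeasure lebesgue ?R"
    using BMO_normD[OF l b(2), of a] l
    by (simp add: f_def nn_integral_half_open_cube emeasure_half_open_cube emeasure_cube)
  then have f_int2: "(\<integral>\<^sup>+x\<in>?R. f x \<partial>lebesgue) \<le> ennreal 2 * emeasure lebesgue ?R"
    using mult_right_mono[of 1 "ennreal 2" "emeasure lebesgue ?R"] by (auto intro: order_trans)
  obtain \<F> where \<F>: "disjoint_subcubes a l \<F>"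
    "\<forall>(c, s)\<in>\<F>. ennreal 2 * emeasure lebesgue (half_open_cube c s) \<le> (\<integral>\<^sup>+x\<in>half_open_cube c s. f x \<partial>lebesgue)"
    "\<forall>(c, s)\<in>\<F>. (\<integral>\<^sup>+x\<in>half_open_cube c s. f x \<partial>lebesgue) \<le> ennreal (2 ^ n * 2) * emeasure lebesgue (half_open_cube c s)"
    "AE x in lebesgue. x \<in> ?R - union_cubes \<F> \<longrightarrow> f x \<le> ennreal 2"
    unfolding n_def by (rule calderon_zygmund[OF l f _ f_int2]) simp
  define U where "U = union_cubes \<F>"
  define G where "G = ?R - U"
  have U [measurable]: "U \<in> sets lebesgue"
    unfolding U_def by (rule sets_union_cubes[OF \<F>(1)])
  have G [measurable]: "G \<in> sets lebesgue" by (simp add: G_def)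
  have U_sub: "U \<subseteq> ?R" using disjoint_subcubesD(2)[OF \<F>(1)] unfolding U_def by blast
  have split_int: "(\<integral>\<^sup>+x\<in>?R. g x \<partial>lebesgue) = (\<integral>\<^sup>+x\<in>G. g x \<partial>lebesgue) + (\<integral>\<^sup>+x\<in>U. g x \<partial>lebesgue)"
    if [measurable]: "g \<in> borel_measurable lebesgue" for g
    using U_sub by (subst nn_integral_add[symmetric]) (auto simp: G_def indicator_def intro!: nn_integral_cong)
  note sum_U = nn_integral_union_cubes[OF _ \<F>(1), folded U_def]
  \<comment> \<open>the selected cubes fill at most half of the cube\<close>
  have "ennreal 2 * emeasure lebesgue U = (\<integral>\<^sup>+x\<in>U. ennreal 2 \<partial>lebesgue)"
    by (simp add: nn_integral_cmult_indicator)
  also have "\<dots> = (\<integral>\<^sup>+p. (\<integral>\<^sup>+x\<in>half_open_cube (fst p) (snd p). ennreal 2 \<partial>lebesgue) \<partial>count_space \<F>)"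
    by (rule sum_U) simp
  also have "\<dots> \<le> (\<integral>\<^sup>+p. (\<integral>\<^sup>+x\<in>half_open_cube (fst p) (snd p). f x \<partial>lebesgue) \<partial>count_space \<F>)"
    using \<F>(2) by (intro nn_integral_mono[of "count_space \<F>"]) (auto simp: nn_integral_cmult_indicator)
  also have "\<dots> = (\<integral>\<^sup>+x\<in>U. f x \<partial>lebesgue)"
    by (rule sum_U[symmetric]) measurable
  also have "\<dots> \<le> (\<integral>\<^sup>+x\<in>?R. f x \<partial>lebesgue)"
    using U_sub by (intro nn_integral_mono) (auto simp: indicator_def)
  also note f_int
  finally have U2: "ennreal 2 * emeasure lebesgue U \<le> emeasure lebesgue ?R" .
  have R_eq: "emeasure lebesgue ?R = emeasure lebesgue G + emeasure lebesgue U"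
    using split_int[of "\<lambda>_. 1"] by simp
  have R_fin: "emeasure lebesgue ?R < top" using l by (simp add: emeasure_half_open_cube)
  obtain g u where gu: "0 \<le> g" "0 \<le> u" "emeasure lebesgue G = ennreal g" "emeasure lebesgue U = ennreal u"
    using R_fin unfolding R_eq by (cases "emeasure lebesgue G"; cases "emeasure lebesgue U") auto
  have R_gu: "emeasure lebesgue ?R = ennreal (g + u)"
    using gu R_eq by simp
  moreover have "ennreal (2 * u) \<le> emeasure lebesgue ?R"
    using U2 gu(2) unfolding gu(4) by (subst ennreal_mult) auto
  ultimately have "2 * u \<le> g + u"
    using gu by (simp del: ennreal_plus)
  note u = this R_gu
  have gu_l: "g + u = l ^ n"
    using u(2) l gu by (simp add: emeasure_half_open_cube n_def del: ennreal_plus)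
  let ?M = "maximal (restricted_weight w a l)"
  have M [measurable]: "?M \<in> borel_measurable lebesgue"
    by (rule borel_measurable_maximal) simp
  define W where "W X = (\<integral>\<^sup>+x\<in>X. w x \<partial>lebesgue)" for X
  \<comment> \<open>the good part carries the average of the weight\<close>
  have W_le: "W ?R \<le> ennreal 2 * (\<integral>\<^sup>+x\<in>G. ?M x \<partial>lebesgue)"
  proof -
    have M_ge: "W ?R / ennreal (l ^ n) \<le> ?M x" if "x \<in> ?R" for x
    proof -
      have "W ?R = emeasure (restricted_weight w a l) (cube a l)"
        unfolding W_def using half_open_cube_subset_cube[of a l]
        by (subst emeasure_restricted_weight) (auto intro!: nn_integral_cong simp: indicator_def)
      then have "W ?R / ennreal (l ^ n) = emeasure (restricted_weight w a l) (cube a l) / emeasure lebesgue (cube a l)"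
        using l by (simp add: emeasure_cube n_def)
      also have "\<dots> \<le> ?M x"
        unfolding maximal_def using that half_open_cube_subset_cube l by (intro SUP_upper) auto
      finally show ?thesis .
    qed
    have "W ?R = W ?R / ennreal (l ^ n) * ennreal (l ^ n)"
      using l by (simp add: ennreal_divide_times)
    also have "\<dots> \<le> W ?R / ennreal (l ^ n) * ennreal (2 * g)"
      using gu_l u by (intro mult_left_mono ennreal_leI) auto
    also have "\<dots> = ennreal 2 * (\<integral>\<^sup>+x\<in>G. W ?R / ennreal (l ^ n) \<partial>lebesgue)"
    proof -
      have "(\<integral>\<^sup>+x\<in>G. W ?R / ennreal (l ^ n) \<partial>lebesgue) = W ?R / ennreal (l ^ n) * ennreal g"
        by (simp add: nn_integral_cmult_indicator gu)
      then show ?thesis using gu by (simp add: ennreal_mult mult_ac)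
    qed
    also have "\<dots> \<le> ennreal 2 * (\<integral>\<^sup>+x\<in>G. ?M x \<partial>lebesgue)"
      using M_ge by (intro mult_left_mono nn_integral_mono) (auto simp: G_def indicator_def)
    finally show ?thesis .
  qed
  have G_part: "(\<integral>\<^sup>+x\<in>G. f x * w x \<partial>lebesgue) \<le> ennreal (2 ^ n * 2) * W G"
  proof -
    have "(\<integral>\<^sup>+x\<in>G. f x * w x \<partial>lebesgue) \<le> (\<integral>\<^sup>+x. ennreal (2 ^ n * 2) * (w x * indicator G x) \<partial>lebesgue)"
    proof (intro nn_integral_mono_AE)
      show "AE x in lebesgue. f x * w x * indicator G x \<le> ennreal (2 ^ n * 2) * (w x * indicator G x)"
        using \<F>(4)
      proof eventually_elim
        case (elim x)
        show ?case
        proof (cases "x \<in> G")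
          case True
          then have "f x \<le> ennreal 2" using elim by (simp add: G_def U_def)
          also have "\<dots> \<le> ennreal (2 ^ n * 2)" by (intro ennreal_leI) simp
          finally show ?thesis using True by (simp add: mult_right_mono)
        qed simp
      qed
    qed
    then show ?thesis unfolding W_def by (simp add: nn_integral_cmult)
  qed
  have cube_part: "(\<integral>\<^sup>+x\<in>half_open_cube c s. f x * w x \<partial>lebesgue)
      \<le> ennreal (2 ^ n * 2) * W (half_open_cube c s)
        + (ennreal K * (\<integral>\<^sup>+x\<in>half_open_cube c s. ?M x \<partial>lebesgue) + e * emeasure lebesgue (half_open_cube c s))"
    if cs: "(c, s) \<in> \<F>" for c s
  proof -
    let ?P = "half_open_cube c s"
    have s: "0 < s" and sub: "?P \<subseteq> ?R" using disjoint_subcubesD[OF \<F>(1) cs] by auto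
    define d where "d = \<bar>average b (cube c s) - average b (cube a l)\<bar>"
    have "ennreal d * emeasure lebesgue ?P \<le> (\<integral>\<^sup>+x\<in>?P. f x \<partial>lebesgue)"
      using average_dist_cube_le[OF locally_integrable_cubeD[OF b(1)] s, of c "average b (cube a l)"] s
      unfolding d_def f_def by (simp add: nn_integral_half_open_cube emeasure_half_open_cube emeasure_cube)
    also have "\<dots> \<le> ennreal (2 ^ n * 2) * emeasure lebesgue ?P" using bspec[OF \<F>(3) cs] by simp
    finally have "ennreal d * ennreal (s ^ n) \<le> ennreal (2 ^ n * 2) * ennreal (s ^ n)"
      using s by (simp add: emeasure_half_open_cube n_def)
    then have d: "ennreal d \<le> ennreal (2 ^ n * 2)"
      using s by (simp add: ennreal_mult[symmetric] d_def)
    have "(\<integral>\<^sup>+x\<in>?P. f x * w x \<partial>lebesgue)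
        \<le> (\<integral>\<^sup>+x. ennreal (2 ^ n * 2) * (w x * indicator ?P x)
            + (ennreal \<bar>b x - average b (cube c s)\<bar> * w x) * indicator ?P x \<partial>lebesgue)"
    proof (intro nn_integral_mono)
      fix x
      have "f x \<le> ennreal d + ennreal \<bar>b x - average b (cube c s)\<bar>"
        unfolding f_def d_def by (simp add: ennreal_leI flip: ennreal_plus)
      also have "\<dots> \<le> ennreal (2 ^ n * 2) + ennreal \<bar>b x - average b (cube c s)\<bar>"
        using d by (rule add_right_mono)
      finally have "f x * w x \<le> (ennreal (2 ^ n * 2) + ennreal \<bar>b x - average b (cube c s)\<bar>) * w x"
        by (rule mult_right_mono) simp
      then show "f x * w x * indicator ?P x \<le> ennreal (2 ^ n * 2) * (w x * indicator ?P x)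
            + (ennreal \<bar>b x - average b (cube c s)\<bar> * w x) * indicator ?P x"
        by (simp add: indicator_def distrib_right)
    qed
    also have "\<dots> = ennreal (2 ^ n * 2) * W ?P
        + (\<integral>\<^sup>+x\<in>?P. ennreal \<bar>b x - average b (cube c s)\<bar> * w x \<partial>lebesgue)"
      unfolding W_def by (simp add: nn_integral_add nn_integral_cmult)
    also have "\<dots> \<le> ennreal (2 ^ n * 2) * W ?P
        + (ennreal K * (\<integral>\<^sup>+x\<in>?P. maximal (restricted_weight w c s) x \<partial>lebesgue) + e * emeasure lebesgue ?P)"
      by (intro add_left_mono bound s)
    also have "\<dots> \<le> ennreal (2 ^ n * 2) * W ?P
        + (ennreal K * (\<integral>\<^sup>+x\<in>?P. ?M x \<partial>lebesgue) + e * emeasure lebesgue ?P)"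
    proof (intro add_left_mono add_right_mono mult_left_mono nn_integral_mono mult_right_mono maximal_mono)
      fix R :: "(real ^ 'n) set" assume "R \<in> cubes"
      then have "R \<in> sets lebesgue" by (auto elim: cubesE)
      then show "emeasure (restricted_weight w c s) R \<le> emeasure (restricted_weight w a l) R"
        using sub by (auto simp: emeasure_restricted_weight indicator_def intro!: nn_integral_mono)
    qed auto
    finally show ?thesis .
  qed
  have "(\<integral>\<^sup>+x\<in>U. f x * w x \<partial>lebesgue)
      = (\<integral>\<^sup>+p. (\<integral>\<^sup>+x\<in>half_open_cube (fst p) (snd p). f x * w x \<partial>lebesgue) \<partial>count_space \<F>)"
    by (rule sum_U) measurable
  also have "\<dots> \<le> (\<integral>\<^sup>+p. ennreal (2 ^ n * 2) * W (half_open_cube (fst p) (snd p))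
        + (ennreal K * (\<integral>\<^sup>+x\<in>half_open_cube (fst p) (snd p). ?M x \<partial>lebesgue)
          + e * emeasure lebesgue (half_open_cube (fst p) (snd p))) \<partial>count_space \<F>)"
    using cube_part by (intro nn_integral_mono) (auto simp del: ennreal_plus)
  also have "\<dots> = ennreal (2 ^ n * 2) * W U + (ennreal K * (\<integral>\<^sup>+x\<in>U. ?M x \<partial>lebesgue) + e * emeasure lebesgue U)"
    using sum_U[of w] sum_U[of ?M] sum_U[of "\<lambda>_. 1"]
    by (simp add: nn_integral_add nn_integral_cmult W_def)
  finally have U_part: "(\<integral>\<^sup>+x\<in>U. f x * w x \<partial>lebesgue)
      \<le> ennreal (2 ^ n * 2) * W U + (ennreal K * (\<integral>\<^sup>+x\<in>U. ?M x \<partial>lebesgue) + e * emeasure lebesgue U)" .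
  have "(\<integral>\<^sup>+x\<in>?R. f x * w x \<partial>lebesgue) = (\<integral>\<^sup>+x\<in>G. f x * w x \<partial>lebesgue) + (\<integral>\<^sup>+x\<in>U. f x * w x \<partial>lebesgue)"
    by (rule split_int) measurable
  also have "\<dots> \<le> ennreal (2 ^ n * 2) * W G
      + (ennreal (2 ^ n * 2) * W U + (ennreal K * (\<integral>\<^sup>+x\<in>U. ?M x \<partial>lebesgue) + e * emeasure lebesgue U))"
    by (intro add_mono G_part U_part)
  also have "\<dots> = ennreal (2 ^ n * 2) * W ?R + (ennreal K * (\<integral>\<^sup>+x\<in>U. ?M x \<partial>lebesgue) + e * emeasure lebesgue U)"
    unfolding W_def by (subst split_int[OF w]) (simp only: distrib_left add.assoc)
  also have "\<dots> \<le> ennreal K * (\<integral>\<^sup>+x\<in>G. ?M x \<partial>lebesgue)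
      + (ennreal K * (\<integral>\<^sup>+x\<in>U. ?M x \<partial>lebesgue) + (e * ennreal (1 / 2)) * emeasure lebesgue ?R)"
  proof (intro add_mono order_refl)
    have "ennreal (2 ^ n * 2) * W ?R \<le> ennreal (2 ^ n * 2) * (ennreal 2 * (\<integral>\<^sup>+x\<in>G. ?M x \<partial>lebesgue))"
      using W_le by (intro mult_left_mono) auto
    also have "\<dots> = ennreal K * (\<integral>\<^sup>+x\<in>G. ?M x \<partial>lebesgue)"
      unfolding K n_def by (subst mult.assoc[symmetric], subst ennreal_mult[symmetric]) auto
    finally show "ennreal (2 ^ n * 2) * W ?R \<le> ennreal K * (\<integral>\<^sup>+x\<in>G. ?M x \<partial>lebesgue)" .
    have "emeasure lebesgue U \<le> ennreal (1 / 2 * (g + u))"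
      unfolding gu(4) using u(1) by (intro ennreal_leI) simp
    also have "\<dots> = ennreal (1 / 2) * emeasure lebesgue ?R"
      unfolding u(2) using gu by (intro ennreal_mult) auto
    finally show "e * emeasure lebesgue U \<le> (e * ennreal (1 / 2)) * emeasure lebesgue ?R"
      unfolding mult.assoc by (rule mult_left_mono) simp
  qed
  also have "\<dots> = ennreal K * (\<integral>\<^sup>+x\<in>?R. ?M x \<partial>lebesgue) + (e * ennreal (1 / 2)) * emeasure lebesgue ?R"
    by (subst split_int[OF M]) (simp only: distrib_left add.assoc)
  finally show ?thesis unfolding f_def .
qed

text \<open>For a weight bounded by \<open>m\<close> the error term \<open>m\<close> is admissible, and
  \<open>oscillation_step\<close> halves it indefinitely. Boundedness of the weight is essential for this start,
  since the integrability of the product of \<open>b\<close> and a general weight is not known.\<close>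

lemma bounded_weight_oscillation_le:
  fixes b :: "real ^ 'n \<Rightarrow> real" and w :: "real ^ 'n \<Rightarrow> ennreal"
  assumes b: "locally_integrable b" "BMO_norm b \<le> 1"
    and w [measurable]: "w \<in> borel_measurable lebesgue" and m: "\<And>x. w x \<le> ennreal m"
    and l: "0 < l"
  shows "(\<integral>\<^sup>+x\<in>half_open_cube a l. ennreal \<bar>b x - average b (cube a l)\<bar> * w x \<partial>lebesgue)
      \<le> ennreal (2 ^ (CARD('n) + 2)) * (\<integral>\<^sup>+x\<in>half_open_cube a l. maximal (restricted_weight w a l) x \<partial>lebesgue)"
    (is "?osc a l \<le> ennreal ?K * ?M a l")
proof -
  note [measurable] = locally_integrable_measurable[OF b(1)]
  have step: "?osc c s \<le> ennreal ?K * ?M c s + ennreal (m * (1 / 2) ^ k) * emeasure lebesgue (half_open_cube c s)"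
    if "0 < s" for k c s
    using that
  proof (induction k arbitrary: c s)
    case 0
    have "?osc c s \<le> (\<integral>\<^sup>+x. ennreal m * (ennreal \<bar>b x - average b (cube c s)\<bar> * indicator (half_open_cube c s) x) \<partial>lebesgue)"
    proof (rule nn_integral_mono)
      fix x
      show "ennreal \<bar>b x - average b (cube c s)\<bar> * w x * indicator (half_open_cube c s) x
          \<le> ennreal m * (ennreal \<bar>b x - average b (cube c s)\<bar> * indicator (half_open_cube c s) x)"
        using mult_left_mono[OF m[of x], of "ennreal \<bar>b x - average b (cube c s)\<bar>"]
        by (auto simp: indicator_def mult.commute[of "ennreal m"])
    qed
    also have "\<dots> = ennreal m * (\<integral>\<^sup>+x\<in>half_open_cube c s. ennreal \<bar>b x - average b (cube c s)\<bar> \<partial>lebesgue)"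
      by (intro nn_integral_cmult) measurable
    also have "\<dots> \<le> ennreal m * emeasure lebesgue (half_open_cube c s)"
      using BMO_normD[OF 0 b(2), of c] 0
      by (intro mult_left_mono) (simp_all add: nn_integral_half_open_cube emeasure_half_open_cube emeasure_cube)
    finally show ?case by (simp add: add_increasing)
  next
    case (Suc k)
    have "?osc c s \<le> ennreal ?K * ?M c s + (ennreal (m * (1 / 2) ^ k) * ennreal (1 / 2)) * emeasure lebesgue (half_open_cube c s)"
      by (rule oscillation_step[OF b w refl Suc.IH Suc.prems])
    moreover have "ennreal (m * (1 / 2) ^ Suc k) = ennreal (m * (1 / 2) ^ k) * ennreal (1 / 2)"
      by (subst ennreal_mult''[symmetric]) (simp_all add: mult_ac)
    ultimately show ?case by (simp only:)
  qed
  show ?thesis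
  proof (rule ennreal_le_epsilon)
    fix e :: real assume e: "0 < e"
    obtain k where k: "(1 / 2) ^ k < e / (\<bar>m\<bar> * l ^ CARD('n) + 1)"
      using real_arch_pow_inv[of "e / (\<bar>m\<bar> * l ^ CARD('n) + 1)" "1 / 2"] e l by (auto simp: add_nonneg_pos)
    have "?osc a l \<le> ennreal ?K * ?M a l + ennreal (m * (1 / 2) ^ k) * emeasure lebesgue (half_open_cube a l)"
      by (rule step[OF l])
    also have "ennreal (m * (1 / 2) ^ k) * emeasure lebesgue (half_open_cube a l) = ennreal (m * (1 / 2) ^ k * l ^ CARD('n))"
      using l by (simp add: emeasure_half_open_cube ennreal_mult'')
    also have "\<dots> \<le> ennreal e"
    proof (rule ennreal_leI)
      have "0 \<le> \<bar>m\<bar> * l ^ CARD('n)" using l by simp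
      then have "(1 / 2) ^ k * (\<bar>m\<bar> * l ^ CARD('n) + 1) < e"
        using k by (simp add: pos_less_divide_eq)
      moreover have "m * (1 / 2) ^ k * l ^ CARD('n) \<le> (1 / 2) ^ k * (\<bar>m\<bar> * l ^ CARD('n))"
        using l by (simp add: mult.commute mult.left_commute mult_right_mono)
      moreover have "(0::real) \<le> (1 / 2) ^ k" by simp
      ultimately show "m * (1 / 2) ^ k * l ^ CARD('n) \<le> e"
        by (simp only: distrib_left mult_1_right)
    qed
    finally show "?osc a l \<le> ennreal ?K * ?M a l + ennreal e" by (simp add: add_left_mono)
  qed
qed

text \<open>Monotone convergence along the truncations of the weight, whose maximal functions are dominated by that of the
  weight.\<close>

lemma weighted_oscillation_le_maximal:
  fixes b v :: "real ^ 'n \<Rightarrow> real"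
  assumes b: "locally_integrable b" "BMO_norm b \<le> 1" and v: "weight v" and Q: "Q \<in> cubes"
  shows "(\<integral>\<^sup>+x\<in>Q. ennreal (\<bar>b x - average b Q\<bar> * v x) \<partial>lebesgue)
    \<le> ennreal (2 ^ (CARD('n) + 2)) * (\<integral>\<^sup>+x\<in>Q. maximal_function (\<lambda>y. v y * indicator Q y) x \<partial>lebesgue)"
proof -
  obtain a l where Q': "Q = cube a l" and l: "0 < l" using Q by (auto elim: cubesE)
  have v_meas [measurable]: "v \<in> borel_measurable lebesgue" and v_nonneg: "0 \<le> v x" for x
    using v by (auto simp: weight_def intro: locally_integrable_measurable)
  note [measurable] = locally_integrable_measurable[OF b(1)]
  let ?K = "2 ^ (CARD('n) + 2) :: real" and ?H = "half_open_cube a l"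
  define w where "w m x = min (ennreal (v x)) (of_nat m)" for m :: nat and x
  have w [measurable]: "w m \<in> borel_measurable lebesgue" for m
    unfolding w_def by measurable
  have M: "maximal_function (\<lambda>y. v y * indicator Q y) = maximal (restricted_weight (\<lambda>x. ennreal (v x)) a l)"
  proof -
    have "density lebesgue (\<lambda>y. ennreal \<bar>v y * indicator Q y\<bar>) = restricted_weight (\<lambda>x. ennreal (v x)) a l"
      unfolding restricted_weight_def Q'
    proof (intro density_cong)
      show "AE x in lebesgue. ennreal \<bar>v x * indicator (cube a l) x\<bar> = ennreal (v x) * indicator ?H x"
        using AE_half_open_cube_iff[of a l] by eventually_elim (simp add: indicator_def v_nonneg)
    qed auto
    then show ?thesis
      by (intro ext) (subst maximal_function_eq_maximal, auto simp: Q')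
  qed
  have "(\<integral>\<^sup>+x\<in>Q. ennreal (\<bar>b x - average b Q\<bar> * v x) \<partial>lebesgue)
      = (\<integral>\<^sup>+x\<in>?H. ennreal (\<bar>b x - average b Q\<bar> * v x) \<partial>lebesgue)"
    unfolding Q' by (rule nn_integral_half_open_cube[symmetric])
  also have "\<dots> = (\<integral>\<^sup>+x. (SUP m. ennreal \<bar>b x - average b Q\<bar> * w m x * indicator ?H x) \<partial>lebesgue)"
  proof (intro nn_integral_cong)
    fix x
    have "(SUP m. w m x) = ennreal (v x)"
    proof (rule antisym)
      obtain m where "v x \<le> real m" using real_arch_simple by blast
      then have "w m x = ennreal (v x)"
        by (simp add: w_def min_def ennreal_of_nat_eq_real_of_nat ennreal_leI)
      then show "ennreal (v x) \<le> (SUP m. w m x)" by (metis SUP_upper UNIV_I)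
    qed (auto simp: w_def intro!: SUP_least)
    then have "ennreal (\<bar>b x - average b Q\<bar> * v x) = (SUP m. ennreal \<bar>b x - average b Q\<bar> * w m x)"
      using v_nonneg by (simp add: ennreal_mult SUP_mult_left_ennreal[symmetric])
    then show "ennreal (\<bar>b x - average b Q\<bar> * v x) * indicator ?H x
        = (SUP m. ennreal \<bar>b x - average b Q\<bar> * w m x * indicator ?H x)"
      by (simp add: SUP_mult_right_ennreal)
  qed
  also have "\<dots> = (SUP m. \<integral>\<^sup>+x\<in>?H. ennreal \<bar>b x - average b Q\<bar> * w m x \<partial>lebesgue)"
  proof (rule nn_integral_monotone_convergence_SUP)
    show "incseq (\<lambda>m x. ennreal \<bar>b x - average b Q\<bar> * w m x * indicator ?H x)"
      unfolding incseq_def le_fun_def w_def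
      by (auto intro!: mult_right_mono mult_left_mono min.mono of_nat_mono)
  qed measurable
  also have "\<dots> \<le> ennreal ?K * (\<integral>\<^sup>+x\<in>?H. maximal (restricted_weight (\<lambda>x. ennreal (v x)) a l) x \<partial>lebesgue)"
  proof (rule SUP_least)
    fix m
    have "(\<integral>\<^sup>+x\<in>?H. ennreal \<bar>b x - average b Q\<bar> * w m x \<partial>lebesgue)
        \<le> ennreal ?K * (\<integral>\<^sup>+x\<in>?H. maximal (restricted_weight (w m) a l) x \<partial>lebesgue)"
      unfolding Q' by (rule bounded_weight_oscillation_le[OF b w _ l, of _ "real m"])
        (simp add: w_def ennreal_of_nat_eq_real_of_nat)
    also have "\<dots> \<le> ennreal ?K * (\<integral>\<^sup>+x\<in>?H. maximal (restricted_weight (\<lambda>x. ennreal (v x)) a l) x \<partial>lebesgue)"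
    proof (intro mult_left_mono nn_integral_mono mult_right_mono maximal_mono)
      fix R :: "(real ^ 'n) set" assume "R \<in> cubes"
      then have "R \<in> sets lebesgue" by (auto elim: cubesE)
      then show "emeasure (restricted_weight (w m) a l) R \<le> emeasure (restricted_weight (\<lambda>x. ennreal (v x)) a l) R"
        by (auto simp: emeasure_restricted_weight w_def intro!: nn_integral_mono mult_right_mono)
    qed auto
    finally show "(\<integral>\<^sup>+x\<in>?H. ennreal \<bar>b x - average b Q\<bar> * w m x \<partial>lebesgue)
        \<le> ennreal ?K * (\<integral>\<^sup>+x\<in>?H. maximal (restricted_weight (\<lambda>x. ennreal (v x)) a l) x \<partial>lebesgue)" .
  qed
  also have "(\<integral>\<^sup>+x\<in>?H. maximal (restricted_weight (\<lambda>x. ennreal (v x)) a l) x \<partial>lebesgue)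
      = (\<integral>\<^sup>+x\<in>Q. maximal_function (\<lambda>y. v y * indicator Q y) x \<partial>lebesgue)"
    unfolding M by (simp add: Q' nn_integral_half_open_cube)
  finally show ?thesis .
qed

section \<open>The equivalence\<close>

theorem theorem1p2:
  "\<exists>c C :: real. 0 < c \<and> 0 < C \<and>
     (\<forall>(v :: real ^ 'n::finite \<Rightarrow> real) (Y :: (real ^ 'n) set \<Rightarrow> real).
        weight v \<longrightarrow> (\<forall>Q\<in>cubes. 0 < Y Q) \<longrightarrow>
          ennreal c * A_infinity_constant v Y
            \<le> (SUP b\<in>{b. locally_integrable b \<and> BMO_norm b = 1}. weighted_BMO_norm v Y b) \<and>
          (SUP b\<in>{b. locally_integrable b \<and> BMO_norm b = 1}. weighted_BMO_norm v Y b)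
            \<le> ennreal C * A_infinity_constant v Y)"
proof (intro exI conjI allI impI)
  let ?L = "lower_constant TYPE('n)" and ?K = "2 ^ (CARD('n) + 2) :: real"
  have L: "0 < ?L"
    by (simp add: lower_constant_def Let_def weak_type_constant_def add_pos_nonneg)
  then show "0 < 1 / ?L" by simp
  show "0 < ?K" by simp
  fix v :: "real ^ 'n \<Rightarrow> real" and Y :: "(real ^ 'n) set \<Rightarrow> real"
  assume v: "weight v" and Y: "\<forall>Q\<in>cubes. 0 < Y Q"
  let ?S = "SUP b\<in>{b. locally_integrable b \<and> BMO_norm b = 1}. weighted_BMO_norm v Y b"
  have "A_infinity_constant v Y \<le> ennreal ?L * ?S"
    unfolding A_infinity_constant_def using v Y by (intro SUP_least maximal_average_le_SUP) auto
  then have "ennreal (1 / ?L) * A_infinity_constant v Y \<le> ennreal (1 / ?L) * (ennreal ?L * ?S)"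
    by (rule mult_left_mono) simp
  also have "\<dots> = (ennreal (1 / ?L) * ennreal ?L) * ?S"
    by (simp only: mult.assoc)
  also have "ennreal (1 / ?L) * ennreal ?L = 1"
    using L by (simp add: ennreal_mult[symmetric])
  finally show "ennreal (1 / ?L) * A_infinity_constant v Y \<le> ?S" by simp
  show "?S \<le> ennreal ?K * A_infinity_constant v Y"
  proof (rule SUP_least)
    fix b :: "real ^ 'n \<Rightarrow> real" assume "b \<in> {b. locally_integrable b \<and> BMO_norm b = 1}"
    then have b: "locally_integrable b" "BMO_norm b \<le> 1" by auto
    show "weighted_BMO_norm v Y b \<le> ennreal ?K * A_infinity_constant v Y"
      unfolding weighted_BMO_norm_def
    proof (rule SUP_least)
      fix Q :: "(real ^ 'n) set" assume Q: "Q \<in> cubes"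
      have "(\<integral>\<^sup>+x\<in>Q. ennreal (\<bar>b x - average b Q\<bar> * v x) \<partial>lebesgue) / ennreal (Y Q)
          \<le> ennreal ?K * ((\<integral>\<^sup>+x\<in>Q. maximal_function (\<lambda>y. v y * indicator Q y) x \<partial>lebesgue) / ennreal (Y Q))"
        unfolding ennreal_times_divide
        by (intro divide_right_mono_ennreal weighted_oscillation_le_maximal b v Q)
      also have "\<dots> \<le> ennreal ?K * A_infinity_constant v Y"
        unfolding A_infinity_constant_def using Q by (intro mult_left_mono SUP_upper) auto
      finally show "(\<integral>\<^sup>+x\<in>Q. ennreal (\<bar>b x - average b Q\<bar> * v x) \<partial>lebesgue) / ennreal (Y Q)
          \<le> ennreal ?K * A_infinity_constant v Y" .
    qed
  qed
qed

end
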